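(* Let $s\ge n+1$, let $\{f_1,\dots,f_s\}$ be a generic set of forms in $R=\mathbb{K}[x_0,\dots,x_n]$, and let $a,m_1,\dots,m_s$ be positive integers with $a\le m_1+\cdots+m_s$. Then $$I_a(f_1^{m_1}\cdots f_s^{m_s})^{\mathrm{sat}}=\bigcap_{c=1}^{n}\left(\bigcap_{1\le i_1<\cdots<i_c\le s}\langle f_{i_1},\dots,f_{i_c}\rangle^{\mu_a(i_1,\dots,i_c)}\right).$$
   Context: $\mathbb{K}$ is an infinite field and $R=\mathbb{K}[x_0,\dots,x_n]$ is standard graded with graded maximal ideal $\mathfrak{m}$; a form is a homogeneous polynomial of positive degree. A set of forms in $R$ is $c$-generic if every subset of size at most $c+1$ forms an $R$-regular sequence; it is generic if it is $n$-generic. The $a$-fold product ideal is $I_a(f_1^{m_1}\cdots f_s^{m_s})=\langle f_1^{n_1}\cdots f_s^{n_s}: 0\le n_i\le m_i \text{ for each } i,\ \sum_i n_i=a\rangle$. For $1\le i_1<\cdots<i_c\le s$ put $\mu_a(i_1,\dots,i_c)=\max\{0,\ a-\sum_{j\in[s]\setminus\{i_1,\dots,i_c\}}m_j\}$ where $[s]=\{1,\dots,s\}$; an ideal raised to the power $0$ is $R$. The saturation of a homogeneous ideal $I$ is $I^{\mathrm{sat}}=\bigcup_{k\ge 1}(I:\mathfrak{m}^k)$. *)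

theory Defs
  imports Complex_Main "HOL-Library.Cardinality" "HOL-Library.Poly_Mapping"
begin

section \<open>Ideals of a commutative ring\<close>

text \<open>
  The ring is the whole type. Ideals are its submodules as a module over itself, so the ideal
  generated by a set is its span.
\<close>

global_interpretation ring_ideal: module "(*) :: 'a \<Rightarrow> 'a \<Rightarrow> 'a::comm_ring_1"
  defines is_ideal = ring_ideal.subspace
    and ideal_gen = ring_ideal.span
  by unfold_locales (simp_all add: algebra_simps)

definition ideal_times :: "'a::comm_ring_1 set \<Rightarrow> 'a set \<Rightarrow> 'a set"
  where "ideal_times I J = ideal_gen {p * q | p q. p \<in> I \<and> q \<in> J}"

primrec ideal_power :: "'a::comm_ring_1 set \<Rightarrow> nat \<Rightarrow> 'a set"
  where
    "ideal_power I 0 = UNIV"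
  | "ideal_power I (Suc k) = ideal_times I (ideal_power I k)"

definition ideal_colon :: "'a::comm_ring_1 set \<Rightarrow> 'a set \<Rightarrow> 'a set"
  where "ideal_colon I J = {p. \<forall>q\<in>J. p * q \<in> I}"

text \<open>
  Each entry is a non-zero-divisor modulo the ideal generated by the preceding ones, and the
  quotient by all of them is not zero.
\<close>

definition regular_sequence :: "'a::comm_ring_1 list \<Rightarrow> bool"
  where "regular_sequence fs \<longleftrightarrow>
    (\<forall>i<length fs. \<forall>p. fs ! i * p \<in> ideal_gen (set (take i fs))
        \<longrightarrow> p \<in> ideal_gen (set (take i fs))) \<and>
    ideal_gen (set fs) \<noteq> UNIV"


section \<open>Polynomial rings\<close>

text \<open>
  The variables are indexed by a finite type \<open>'x\<close>, so that \<open>('x, 'k) mpoly_ring\<close> is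
  \<open>K[x\<^sub>0, \<dots>, x\<^sub>n]\<close> with \<open>n + 1 = CARD('x)\<close>. Exponent vectors are elements of \<open>'x \<Rightarrow>\<^sub>0 nat\<close>.
\<close>

type_synonym ('x, 'k) mpoly_ring = "('x \<Rightarrow>\<^sub>0 nat) \<Rightarrow>\<^sub>0 'k"

definition variable :: "'x \<Rightarrow> ('x::finite, 'k::field) mpoly_ring"
  where "variable x = Poly_Mapping.single (Poly_Mapping.single x 1) 1"

definition total_degree :: "('x::finite \<Rightarrow>\<^sub>0 nat) \<Rightarrow> nat"
  where "total_degree e = (\<Sum>x\<in>UNIV. Poly_Mapping.lookup e x)"

definition homogeneous :: "nat \<Rightarrow> ('x::finite, 'k::field) mpoly_ring \<Rightarrow> bool"
  where "homogeneous d p \<longleftrightarrow> (\<forall>e\<in>Poly_Mapping.keys p. total_degree e = d)"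

text \<open>
  The zero polynomial counts as homogeneous of every degree; it never belongs to a
  \<open>c\<close>-generic set, since a single zero is not a regular sequence.
\<close>

definition is_form :: "('x::finite, 'k::field) mpoly_ring \<Rightarrow> bool"
  where "is_form p \<longleftrightarrow> (\<exists>d>0. homogeneous d p)"

definition graded_max_ideal :: "('x::finite, 'k::field) mpoly_ring set"
  where "graded_max_ideal = ideal_gen (range variable)"

definition saturation :: "('x::finite, 'k::field) mpoly_ring set \<Rightarrow> ('x, 'k) mpoly_ring set"
  where "saturation I = (\<Union>k\<in>{1..}. ideal_colon I (ideal_power graded_max_ideal k))"


section \<open>Generic sets of forms and ideals of fold products\<close>

text \<open>
  A set forms a regular sequence if some enumeration of it is one. For forms of positive degree
  in a polynomial ring, this does not depend on the enumeration.
\<close>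

definition generic_forms :: "nat \<Rightarrow> ('x::finite, 'k::field) mpoly_ring set \<Rightarrow> bool"
  where "generic_forms c F \<longleftrightarrow>
    (\<forall>p\<in>F. is_form p) \<and>
    (\<forall>T\<subseteq>F. finite T \<and> card T \<le> c + 1
        \<longrightarrow> (\<exists>fs. distinct fs \<and> set fs = T \<and> regular_sequence fs))"

definition fold_product_ideal ::
    "nat \<Rightarrow> (nat \<Rightarrow> 'a::comm_ring_1) \<Rightarrow> (nat \<Rightarrow> nat) \<Rightarrow> nat \<Rightarrow> 'a set"
  where "fold_product_ideal s f m a =
    ideal_gen {\<Prod>i=1..s. f i ^ e i | e. (\<forall>i\<in>{1..s}. e i \<le> m i) \<and> (\<Sum>i=1..s. e i) = a}"

text \<open>
  The indices \<open>i\<^sub>1 < \<dots> < i\<^sub>c\<close> are given as the set \<open>C\<close>; truncated subtraction on the naturals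
  supplies the maximum with 0.
\<close>

definition mu :: "nat \<Rightarrow> (nat \<Rightarrow> nat) \<Rightarrow> nat \<Rightarrow> nat set \<Rightarrow> nat"
  where "mu s m a C = a - (\<Sum>j\<in>{1..s} - C. m j)"

end

theory Submission
  imports Defs "HOL-Library.FuncSet"
begin

text \<open>
  Let \<open>T\<close> index at most \<open>n + 1\<close> of the forms and let \<open>W\<close> be a graded vector space complement of
  the ideal they generate. Regularity makes \<open>R\<close> the direct sum of the spaces \<open>W f\<^sup>\<alpha>\<close>, where
  \<open>f\<^sup>\<alpha>\<close> ranges over the power products of the \<open>f\<^sub>i\<close> with \<open>i \<in> T\<close>. So powers of the ideals generated
  by subsets of these forms behave like monomial ideals: membership is a condition on
  exponents. Hence a form outside a subset is a nonzerodivisor modulo the powers of the ideal of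
  the subset, which gives one inclusion.

  For the other one, let \<open>p\<close> lie in the intersection. If \<open>e\<^sub>i \<ge> m\<^sub>i\<close> for all but at most \<open>n\<close> indices,
  comparing exponents shows that \<open>p f\<^sup>e\<close> lies in the fold product ideal. Otherwise \<open>n + 1\<close> indices
  have \<open>e\<^sub>i < m\<^sub>i\<close>, the forms at them generate an ideal that contains a power of the maximal
  ideal, and \<open>p f\<^sup>e\<close> lies in the saturation as soon as all \<open>p f\<^sup>e f\<^sub>i\<close> do. Descending induction
  ends at \<open>e = 0\<close>.
\<close>

text \<open>
  As an instance of associativity oriented to the left, this simplification rule loops with
  \<open>mult.assoc\<close> and the other rules for associative-commutative rewriting.
\<close>

declare ring_ideal.scale_scale [simp del]

section \<open>Regular sequences and quasi-regularity\<close>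

lemma regular_combination_zero:
  fixes g :: "'a::comm_ring_1"
  assumes "\<And>p. g * p \<in> ideal_gen A \<Longrightarrow> p \<in> ideal_gen A"
    and "(\<Sum>k<N. w k * g ^ k) \<in> ideal_gen A"
    and "\<And>k. k < N \<Longrightarrow> w k \<in> ideal_gen (insert g A) \<Longrightarrow> w k = 0"
    and "k < N"
  shows "w k = 0"
  using assms(2-4)
proof (induction N arbitrary: w k)
  case (Suc N)
  \<comment> \<open>Horner form: the sum is \<open>w 0 + g * r\<close>, so \<open>w 0\<close> lies
    in the ideal generated by \<open>A\<close> and \<open>g\<close> and is therefore 0. Then
    \<open>g\<close> can be cancelled from \<open>g * r\<close>, which leaves the same situation for
    the shorter sum \<open>r\<close>.\<close>
  define r where "r = (\<Sum>k<N. w (Suc k) * g ^ k)"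
  have split: "(\<Sum>k<Suc N. w k * g ^ k) = w 0 + g * r"
    unfolding sum.lessThan_Suc_shift r_def sum_distrib_left by (simp add: ac_simps)
  have sum_in: "w 0 + g * r \<in> ideal_gen A"
    using Suc.prems(1) by (simp only: split)
  hence "w 0 + g * r \<in> ideal_gen (insert g A)"
    using ring_ideal.span_mono[of A "insert g A"] by auto
  moreover have "g * r \<in> ideal_gen (insert g A)"
    using ring_ideal.span_scale[OF ring_ideal.span_base[of g "insert g A"], of r]
    by (simp add: mult.commute)
  ultimately have "w 0 \<in> ideal_gen (insert g A)"
    using ring_ideal.span_add_eq2 by blast
  hence w0: "w 0 = 0"
    using Suc.prems(2) by blast
  hence "r \<in> ideal_gen A"
    using sum_in assms(1) by simp
  hence "\<And>k. k < N \<Longrightarrow> w (Suc k) = 0"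
    using Suc.IH[of "\<lambda>k. w (Suc k)"] Suc.prems(2) by (simp add: r_def)
  with w0 show ?case
    using Suc.prems(3) by (cases k) auto
qed simp

text \<open>Exponent vectors are total functions that vanish off \<open>T\<close>, so that distinct
  vectors have distinct restrictions to \<open>T\<close>.\<close>

definition exponents :: "'i set \<Rightarrow> ('i \<Rightarrow> nat) set"
  where "exponents T = {\<alpha>. \<forall>i. i \<notin> T \<longrightarrow> \<alpha> i = 0}"

definition power_product :: "('i \<Rightarrow> 'a::comm_ring_1) \<Rightarrow> 'i set \<Rightarrow> ('i \<Rightarrow> nat) \<Rightarrow> 'a"
  where "power_product f T \<alpha> = (\<Prod>i\<in>T. f i ^ \<alpha> i)"

lemma power_product_Suc:
  assumes "finite T" "i \<in> T"
  shows "power_product f T (\<alpha>(i := Suc (\<alpha> i))) = f i * power_product f T \<alpha>"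
proof -
  have "(\<Prod>k\<in>T - {i}. f k ^ (\<alpha>(i := Suc (\<alpha> i))) k) = (\<Prod>k\<in>T - {i}. f k ^ \<alpha> k)"
    by (rule prod.cong) auto
  thus ?thesis
    unfolding power_product_def using assms
    by (simp add: prod.remove[of T i] mult.assoc)
qed

text \<open>The sequence is given by indices instead of ring elements, so that exponent vectors can
  be functions of the index.\<close>

definition regular_family :: "('i \<Rightarrow> 'a::comm_ring_1) \<Rightarrow> 'i list \<Rightarrow> bool"
  where "regular_family f is \<longleftrightarrow> distinct is \<and>
    (\<forall>k<length is. \<forall>p. f (is ! k) * p \<in> ideal_gen (f ` set (take k is))
        \<longrightarrow> p \<in> ideal_gen (f ` set (take k is)))"

lemma regular_family_snocD:
  assumes "regular_family f (is @ [j])"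
  shows "regular_family f is" "j \<notin> set is"
    "\<And>p. f j * p \<in> ideal_gen (f ` set is) \<Longrightarrow> p \<in> ideal_gen (f ` set is)"
proof -
  have nz: "p \<in> ideal_gen (f ` set (take k (is @ [j])))"
    if "k < length (is @ [j])" "f ((is @ [j]) ! k) * p \<in> ideal_gen (f ` set (take k (is @ [j])))" for k p
    using assms that unfolding regular_family_def by blast
  show "j \<notin> set is"
    using assms unfolding regular_family_def by simp
  show "\<And>p. f j * p \<in> ideal_gen (f ` set is) \<Longrightarrow> p \<in> ideal_gen (f ` set is)"
    using nz[of "length is"] by (simp only: length_append_singleton lessI nth_append_length take_append
        diff_self_eq_0 take_0 append_Nil2 take_all order_refl simp_thms)
  have "p \<in> ideal_gen (f ` set (take k is))"
    if "k < length is" "f (is ! k) * p \<in> ideal_gen (f ` set (take k is))" for k p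
  proof -
    have "(is @ [j]) ! k = is ! k" "take k (is @ [j]) = take k is" "k < length (is @ [j])"
      using that(1) by (simp_all add: nth_append)
    thus ?thesis
      using nz[of k p] that(2) by metis
  qed
  moreover have "distinct is"
    using assms by (simp add: regular_family_def)
  ultimately show "regular_family f is"
    unfolding regular_family_def by blast
qed

text \<open>A form of independence of the power products: coefficients are drawn from elements that
  are either 0 or outside the ideal, as happens for elements of a complement of the ideal. The sums
  may mix total exponents.\<close>

definition quasi_regular :: "('i \<Rightarrow> 'a::comm_ring_1) \<Rightarrow> 'i set \<Rightarrow> bool"
  where "quasi_regular f T \<longleftrightarrow> (\<forall>S w. finite S \<longrightarrow> S \<subseteq> exponents T \<longrightarrow>
    (\<forall>\<alpha>\<in>S. w \<alpha> \<in> ideal_gen (f ` T) \<longrightarrow> w \<alpha> = 0) \<longrightarrow>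
    (\<Sum>\<alpha>\<in>S. w \<alpha> * power_product f T \<alpha>) = 0 \<longrightarrow> (\<forall>\<alpha>\<in>S. w \<alpha> = 0))"

text \<open>
  Powers of the new element are collected first: with the other exponents fixed they form a
  polynomial in it, to which \<open>regular_combination_zero\<close> applies.
\<close>

lemma quasi_regular_insert:
  fixes f :: "'i \<Rightarrow> 'a::comm_ring_1"
  assumes quasi: "quasi_regular f T" and T: "finite T" "j \<notin> T"
    and nonzerodivisor: "\<And>p. f j * p \<in> ideal_gen (f ` T) \<Longrightarrow> p \<in> ideal_gen (f ` T)"
  shows "quasi_regular f (insert j T)"
  unfolding quasi_regular_def
proof (intro allI impI)
  fix S and w :: "('i \<Rightarrow> nat) \<Rightarrow> 'a"
  assume finS: "finite S" and S: "S \<subseteq> exponents (insert j T)"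
    and w: "\<forall>\<alpha>\<in>S. w \<alpha> \<in> ideal_gen (f ` insert j T) \<longrightarrow> w \<alpha> = 0"
    and zero: "(\<Sum>\<alpha>\<in>S. w \<alpha> * power_product f (insert j T) \<alpha>) = 0"
  \<comment> \<open>\<open>\<pi>\<close> forgets the exponent of \<open>j\<close>; the terms of the
    sum are grouped by the remaining exponents, and \<open>v \<beta>\<close> is the collected
    coefficient of the group of \<open>\<beta>\<close>.\<close>
  define \<pi> where "\<pi> \<alpha> = \<alpha>(j := 0)" for \<alpha> :: "'i \<Rightarrow> nat"
  define fib where "fib \<beta> = {\<alpha>\<in>S. \<pi> \<alpha> = \<beta>}" for \<beta>
  define v where "v \<beta> = (\<Sum>\<alpha>\<in>fib \<beta>. w \<alpha> * f j ^ \<alpha> j)" for \<beta>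
  have fin: "finite (fib \<beta>)" for \<beta>
    using finS by (simp add: fib_def)
  have pp: "power_product f (insert j T) \<alpha> = f j ^ \<alpha> j * power_product f T (\<pi> \<alpha>)" for \<alpha>
  proof -
    have "power_product f T (\<pi> \<alpha>) = power_product f T \<alpha>"
      unfolding power_product_def using T by (intro prod.cong) (auto simp: \<pi>_def)
    thus ?thesis
      using T by (simp add: power_product_def)
  qed
  have zero_if: "w \<alpha> = 0" if \<alpha>: "\<alpha> \<in> fib \<beta>" and vI: "v \<beta> \<in> ideal_gen (f ` T)" for \<alpha> \<beta>
  proof -
    \<comment> \<open>The default 0 off the fibre turns \<open>v \<beta>\<close> into a polynomial
      in \<open>f j\<close> with a coefficient for every \<open>k < N\<close>.\<close>
    define u where "u k = (if \<beta>(j := k) \<in> fib \<beta> then w (\<beta>(j := k)) else 0)" for k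
    define N where "N = Suc (Max ((\<lambda>\<alpha>. \<alpha> j) ` fib \<beta>))"
    have less: "\<gamma> j < N" if "\<gamma> \<in> fib \<beta>" for \<gamma>
      using fin that by (auto simp: N_def less_Suc_eq_le)
    have upd: "\<beta>(j := \<gamma> j) = \<gamma>" if "\<gamma> \<in> fib \<beta>" for \<gamma>
      using that by (auto simp: fib_def \<pi>_def)
    have inj: "inj_on (\<lambda>\<gamma>. \<gamma> j) (fib \<beta>)"
      by (rule inj_onI) (metis upd)
    have "v \<beta> = (\<Sum>k\<in>(\<lambda>\<gamma>. \<gamma> j) ` fib \<beta>. u k * f j ^ k)"
      unfolding v_def by (subst sum.reindex[OF inj]) (simp add: u_def upd cong: sum.cong)
    also have "\<dots> = (\<Sum>k<N. u k * f j ^ k)"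
    proof (rule sum.mono_neutral_left)
      show "\<forall>k\<in>{..<N} - (\<lambda>\<gamma>. \<gamma> j) ` fib \<beta>. u k * f j ^ k = 0"
        by (auto simp: u_def image_iff) (metis fun_upd_same)
    qed (auto simp: less)
    finally have v: "v \<beta> = (\<Sum>k<N. u k * f j ^ k)" .
    have "u k = 0" if "k < N" "u k \<in> ideal_gen (insert (f j) (f ` T))" for k
      using that w by (auto simp: u_def fib_def)
    hence "u (\<alpha> j) = 0"
      using regular_combination_zero[OF nonzerodivisor, where N = N and w = u and k = "\<alpha> j"] less[OF \<alpha>] vI v by auto
    thus ?thesis
      using upd \<alpha> by (simp add: u_def)
  qed
  have sub: "\<pi> ` S \<subseteq> exponents T"
      using S by (auto simp: exponents_def \<pi>_def)
    \<comment> \<open>A collected coefficient in the ideal of \<open>T\<close> has a vanishing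
      fibre, hence is 0. So the \<open>v \<beta>\<close> meet the condition on coefficients in
      \<open>quasi_regular f T\<close>.\<close>
    have "v \<beta> = 0" if "v \<beta> \<in> ideal_gen (f ` T)" for \<beta>
      unfolding v_def by (intro sum.neutral ballI) (simp only: zero_if[OF _ that] mult_zero_left)
  hence v_in: "\<forall>\<beta>\<in>\<pi> ` S. v \<beta> \<in> ideal_gen (f ` T) \<longrightarrow> v \<beta> = 0"
      by blast
    have "(\<Sum>\<beta>\<in>\<pi> ` S. v \<beta> * power_product f T \<beta>)
        = (\<Sum>\<beta>\<in>\<pi> ` S. \<Sum>\<alpha>\<in>fib \<beta>. w \<alpha> * power_product f (insert j T) \<alpha>)"
    proof (rule sum.cong[OF refl])
      fix \<beta>
      have "v \<beta> * power_product f T \<beta> = (\<Sum>\<alpha>\<in>fib \<beta>. w \<alpha> * f j ^ \<alpha> j * power_product f T \<beta>)"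
        unfolding v_def by (rule sum_distrib_right)
      also have "\<dots> = (\<Sum>\<alpha>\<in>fib \<beta>. w \<alpha> * power_product f (insert j T) \<alpha>)"
      proof (rule sum.cong[OF refl])
        fix \<alpha> assume "\<alpha> \<in> fib \<beta>"
        hence "\<pi> \<alpha> = \<beta>"
          by (simp only: fib_def mem_Collect_eq)
        thus "w \<alpha> * f j ^ \<alpha> j * power_product f T \<beta> = w \<alpha> * power_product f (insert j T) \<alpha>"
          by (simp only: pp mult.assoc)
      qed
      finally show "v \<beta> * power_product f T \<beta>
          = (\<Sum>\<alpha>\<in>fib \<beta>. w \<alpha> * power_product f (insert j T) \<alpha>)" .
    qed
    also have "\<dots> = (\<Sum>\<alpha>\<in>S. w \<alpha> * power_product f (insert j T) \<alpha>)"
      unfolding fib_def by (rule sum.image_gen[symmetric]) (rule finS)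
    finally have "(\<Sum>\<beta>\<in>\<pi> ` S. v \<beta> * power_product f T \<beta>) = 0"
      using zero by simp
  hence "\<forall>\<beta>\<in>\<pi> ` S. v \<beta> = 0"
    using quasi finS sub v_in unfolding quasi_regular_def by blast
  \<comment> \<open>Every \<open>v\<close> is now 0 and so lies in the ideal; \<open>zero_if\<close>
    applies a second time, to all fibres.\<close>
  hence "\<forall>\<alpha>\<in>S. v (\<pi> \<alpha>) \<in> ideal_gen (f ` T)"
    by (simp add: ring_ideal.span_zero)
  moreover have "\<forall>\<alpha>\<in>S. \<alpha> \<in> fib (\<pi> \<alpha>)"
    unfolding fib_def by blast
  ultimately show "\<forall>\<alpha>\<in>S. w \<alpha> = 0"
    using zero_if by blast
qed

lemma regular_family_quasi_regular:
  assumes "regular_family f is"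
  shows "quasi_regular f (set is)"
  using assms
proof (induction "is" rule: rev_induct)
  case Nil
  show ?case
    unfolding quasi_regular_def
  proof (intro allI impI ballI)
    fix S and w :: "('a \<Rightarrow> nat) \<Rightarrow> 'b" and \<alpha> :: "'a \<Rightarrow> nat"
    assume S: "S \<subseteq> exponents (set [])" and zero: "(\<Sum>\<alpha>\<in>S. w \<alpha> * power_product f (set []) \<alpha>) = 0"
      and \<alpha>: "\<alpha> \<in> S"
    have "S \<subseteq> {\<lambda>_. 0}"
      using S by (auto simp: exponents_def)
    hence "S = {\<alpha>}"
      using \<alpha> by blast
    thus "w \<alpha> = 0"
      using zero by (simp add: power_product_def)
  qed
next
  case (snoc j "is")
  show ?case
    using regular_family_snocD[OF snoc.prems] snoc.IH quasi_regular_insert[of f "set is" j] by simp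
qed


section \<open>Monomial expansions along a quasi-regular family\<close>

text \<open>\<open>W\<close> is an additive group that meets the ideal only in 0. Coefficients and
  their differences therefore always satisfy the condition in \<open>quasi_regular\<close>.\<close>

locale quasi_regular_family =
  fixes f :: "'i \<Rightarrow> 'a::comm_ring_1" and T :: "'i set" and W :: "'a set"
  assumes finite_T: "finite T" and quasi_regular: "quasi_regular f T"
    and W_zero: "0 \<in> W" and W_diff: "\<And>v w. v \<in> W \<Longrightarrow> w \<in> W \<Longrightarrow> v - w \<in> W"
    and W_ideal: "\<And>w. w \<in> W \<Longrightarrow> w \<in> ideal_gen (f ` T) \<Longrightarrow> w = 0"
begin

definition expands :: "'a \<Rightarrow> (('i \<Rightarrow> nat) \<Rightarrow> 'a) \<Rightarrow> bool"
  where "expands p w \<longleftrightarrow> finite {\<alpha>. w \<alpha> \<noteq> 0} \<and> {\<alpha>. w \<alpha> \<noteq> 0} \<subseteq> exponents T \<and> range w \<subseteq> W \<and>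
    p = (\<Sum>\<alpha> | w \<alpha> \<noteq> 0. w \<alpha> * power_product f T \<alpha>)"

lemma expands_on:
  assumes "finite S" "{\<alpha>. w \<alpha> \<noteq> 0} \<subseteq> S"
  shows "(\<Sum>\<alpha> | w \<alpha> \<noteq> 0. w \<alpha> * power_product f T \<alpha>) = (\<Sum>\<alpha>\<in>S. w \<alpha> * power_product f T \<alpha>)"
  by (rule sum.mono_neutral_left) (use assms in auto)

lemma W_add: "v \<in> W \<Longrightarrow> w \<in> W \<Longrightarrow> v + w \<in> W"
  using W_diff[of v "0 - w"] W_diff[of 0 w] W_zero by simp

lemma expands_add:
  assumes "expands p v" "expands q w"
  shows "expands (p + q) (\<lambda>\<alpha>. v \<alpha> + w \<alpha>)"
proof -
  define S where "S = {\<alpha>. v \<alpha> \<noteq> 0} \<union> {\<alpha>. w \<alpha> \<noteq> 0}"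
  have S: "finite S" "S \<subseteq> exponents T"
    using assms by (auto simp: S_def expands_def)
  have sub: "{\<alpha>. v \<alpha> \<noteq> 0} \<subseteq> S" "{\<alpha>. w \<alpha> \<noteq> 0} \<subseteq> S" "{\<alpha>. v \<alpha> + w \<alpha> \<noteq> 0} \<subseteq> S"
    by (auto simp: S_def)
  have "p + q = (\<Sum>\<alpha>\<in>S. (v \<alpha> + w \<alpha>) * power_product f T \<alpha>)"
    using assms expands_on[OF S(1) sub(1)] expands_on[OF S(1) sub(2)]
    by (simp add: expands_def distrib_right sum.distrib)
  also have "\<dots> = (\<Sum>\<alpha> | v \<alpha> + w \<alpha> \<noteq> 0. (v \<alpha> + w \<alpha>) * power_product f T \<alpha>)"
    using expands_on[OF S(1) sub(3)] by simp
  finally show ?thesis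
    using assms S sub(3) finite_subset[OF sub(3)] W_add unfolding expands_def image_subset_iff
    by auto
qed

text \<open>The differences of the coefficients stay in \<open>W\<close>, so a nonzero one would lie
  outside the ideal, and quasi-regularity rules this out.\<close>

lemma expands_unique:
  assumes "expands p v" "expands p w"
  shows "v = w"
proof
  fix \<alpha>
  define S where "S = {\<alpha>. v \<alpha> \<noteq> 0} \<union> {\<alpha>. w \<alpha> \<noteq> 0}"
  have S: "finite S" "S \<subseteq> exponents T"
    using assms by (auto simp: S_def expands_def)
  have sub: "{\<alpha>. v \<alpha> \<noteq> 0} \<subseteq> S" "{\<alpha>. w \<alpha> \<noteq> 0} \<subseteq> S"
    by (auto simp: S_def)
  have "(\<Sum>\<alpha>\<in>S. (v \<alpha> - w \<alpha>) * power_product f T \<alpha>) = p - p"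
    using assms expands_on[OF S(1) sub(1)] expands_on[OF S(1) sub(2)]
    by (simp add: expands_def left_diff_distrib sum_subtractf)
  hence "(\<Sum>\<alpha>\<in>S. (v \<alpha> - w \<alpha>) * power_product f T \<alpha>) = 0"
    by simp
  moreover have "v \<alpha> - w \<alpha> \<in> W" for \<alpha>
    using assms by (intro W_diff) (auto simp: expands_def)
  hence "\<forall>\<alpha>\<in>S. v \<alpha> - w \<alpha> \<in> ideal_gen (f ` T) \<longrightarrow> v \<alpha> - w \<alpha> = 0"
    using W_ideal by blast
  ultimately have "\<forall>\<alpha>\<in>S. v \<alpha> - w \<alpha> = 0"
    using quasi_regular[unfolded quasi_regular_def, rule_format, OF S, of "\<lambda>\<alpha>. v \<alpha> - w \<alpha>"] by blast
  hence "v \<alpha> - w \<alpha> = 0" if "\<alpha> \<in> S"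
    using that by blast
  thus "v \<alpha> = w \<alpha>"
    by (cases "\<alpha> \<in> S") (simp_all add: S_def)
qed

text \<open>Multiplication by \<open>f i\<close> moves each term to the next exponent of
  \<open>i\<close> and keeps its coefficient, as for monomials. The shift \<open>\<sigma>\<close> is
  injective and carries the old support onto the new one.\<close>

lemma expands_mult:
  assumes "expands p w" "i \<in> T"
  shows "expands (f i * p) (\<lambda>\<alpha>. if \<alpha> i = 0 then 0 else w (\<alpha>(i := \<alpha> i - 1)))" (is "expands _ ?v")
proof -
  define \<sigma> where "\<sigma> \<alpha> = \<alpha>(i := Suc (\<alpha> i))" for \<alpha> :: "'i \<Rightarrow> nat"
  have inj: "inj \<sigma>"
  proof (rule injI)
    fix \<alpha> \<beta> assume eq: "\<sigma> \<alpha> = \<sigma> \<beta>"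
    show "\<alpha> = \<beta>"
    proof
      fix k show "\<alpha> k = \<beta> k"
        using fun_cong[OF eq, of k] by (auto simp: \<sigma>_def split: if_splits)
    qed
  qed
  have v\<sigma>: "?v (\<sigma> \<alpha>) = w \<alpha>" for \<alpha>
    by (simp add: \<sigma>_def)
  have supp: "{\<alpha>. ?v \<alpha> \<noteq> 0} = \<sigma> ` {\<alpha>. w \<alpha> \<noteq> 0}"
  proof safe
    fix \<alpha> assume "?v \<alpha> \<noteq> 0"
    hence "\<alpha> = \<sigma> (\<alpha>(i := \<alpha> i - 1))" "w (\<alpha>(i := \<alpha> i - 1)) \<noteq> 0"
      by (auto simp: \<sigma>_def split: if_splits)
    thus "\<alpha> \<in> \<sigma> ` {\<alpha>. w \<alpha> \<noteq> 0}"
      by blast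
  qed (simp add: v\<sigma>)
  have "(\<Sum>\<alpha> | ?v \<alpha> \<noteq> 0. ?v \<alpha> * power_product f T \<alpha>)
      = (\<Sum>\<alpha> | w \<alpha> \<noteq> 0. ?v (\<sigma> \<alpha>) * power_product f T (\<sigma> \<alpha>))"
    unfolding supp by (rule sum.reindex_cong[OF inj_on_subset[OF inj]]) auto
  also have "\<dots> = (\<Sum>\<alpha> | w \<alpha> \<noteq> 0. w \<alpha> * (f i * power_product f T \<alpha>))"
    unfolding v\<sigma> by (simp add: \<sigma>_def power_product_Suc finite_T assms(2))
  also have "\<dots> = f i * p"
    using assms(1) by (simp add: expands_def sum_distrib_left mult.left_commute)
  finally have "f i * p = (\<Sum>\<alpha> | ?v \<alpha> \<noteq> 0. ?v \<alpha> * power_product f T \<alpha>)" ..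
  moreover have "finite {\<alpha>. ?v \<alpha> \<noteq> 0}"
    using assms(1) unfolding supp expands_def by blast
  moreover have "{\<alpha>. ?v \<alpha> \<noteq> 0} \<subseteq> exponents T"
    using assms unfolding supp expands_def exponents_def by (auto simp: \<sigma>_def)
  moreover have "range ?v \<subseteq> W"
    using assms(1) W_zero by (auto simp: expands_def)
  ultimately show ?thesis
    unfolding expands_def by blast
qed

lemma expands_W:
  assumes "w \<in> W"
  shows "expands w (\<lambda>\<alpha>. if \<alpha> = (\<lambda>_. 0) then w else 0)"
proof -
  have "{\<alpha>. (if \<alpha> = (\<lambda>_. 0) then w else 0) \<noteq> 0} \<subseteq> {(\<lambda>_. 0) :: 'i \<Rightarrow> nat}"
    by auto
  from expands_on[OF _ this] finite_subset[OF this] show ?thesis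
    using assms W_zero by (auto simp: expands_def exponents_def power_product_def)
qed

end

text \<open>
  The ring is the direct sum of the translates of \<open>W\<close> by the power products in \<open>f\<close>.
\<close>

locale power_decomposition = quasi_regular_family f T W
  for f :: "'i \<Rightarrow> 'a::comm_ring_1" and T :: "'i set" and W :: "'a set" +
  assumes expansion: "\<exists>w. expands p w"
begin

definition coef :: "'a \<Rightarrow> ('i \<Rightarrow> nat) \<Rightarrow> 'a"
  where "coef p = (SOME w. expands p w)"

lemma coef_eqI: "expands p w \<Longrightarrow> coef p = w"
  using expands_unique someI_ex[OF expansion] unfolding coef_def by blast

lemma expands_coef: "expands p (coef p)"
  using someI_ex[OF expansion] unfolding coef_def .

lemma coef_add: "coef (p + q) \<alpha> = coef p \<alpha> + coef q \<alpha>"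
  using coef_eqI[OF expands_add[OF expands_coef expands_coef]] by simp

lemma coef_mult: "i \<in> T \<Longrightarrow> coef (f i * p) \<alpha> = (if \<alpha> i = 0 then 0 else coef p (\<alpha>(i := \<alpha> i - 1)))"
  using coef_eqI[OF expands_mult[OF expands_coef]] by simp

lemma coef_power_mult:
  assumes "i \<in> T"
  shows "coef (f i ^ k * p) \<alpha> = (if \<alpha> i < k then 0 else coef p (\<alpha>(i := \<alpha> i - k)))"
proof (induction k arbitrary: \<alpha>)
  case (Suc k)
  show ?case
    using coef_mult[OF assms, of "f i ^ k * p" \<alpha>] unfolding Suc.IH
    by (auto simp: mult.assoc fun_upd_same simp del: fun_upd_apply)
qed simp

text \<open>The analogue of the span of a set of monomials; for upward closed \<open>A\<close> it
  plays the role of a monomial ideal.\<close>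

definition supported :: "('i \<Rightarrow> nat) set \<Rightarrow> 'a set"
  where "supported A = {p. \<forall>\<alpha>. coef p \<alpha> \<noteq> 0 \<longrightarrow> \<alpha> \<in> A}"

lemma supported_add: "p \<in> supported A \<Longrightarrow> q \<in> supported A \<Longrightarrow> p + q \<in> supported A"
  by (auto simp: supported_def coef_add) (metis add.right_neutral)

lemma supported_zero: "0 \<in> supported A"
  using coef_add[of 0 0] by (auto simp: supported_def)

lemma supported_sum: "(\<And>x. x \<in> X \<Longrightarrow> g x \<in> supported A) \<Longrightarrow> sum g X \<in> supported A"
  by (induction X rule: infinite_finite_induct) (auto intro: supported_add supported_zero)

lemma supported_mono: "A \<subseteq> B \<Longrightarrow> supported A \<subseteq> supported B"
  by (auto simp: supported_def)

lemma expansion_coef: "p = (\<Sum>\<alpha> | coef p \<alpha> \<noteq> 0. coef p \<alpha> * power_product f T \<alpha>)"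
  using expands_coef[of p] unfolding expands_def by blast

lemma coef_nonzero_exponents: "coef p \<alpha> \<noteq> 0 \<Longrightarrow> \<alpha> \<in> exponents T"
  using expands_coef[of p] unfolding expands_def by blast

lemma power_product_mult_supported: "q * power_product f T \<alpha> \<in> supported {\<gamma>. \<forall>i\<in>T. \<alpha> i \<le> \<gamma> i}"
proof -
  \<comment> \<open>Partial products over \<open>U\<close> allow the powers to be multiplied on one
    index at a time; each shifts the expansion of what it multiplies.\<close>
  have "coef ((\<Prod>i\<in>U. f i ^ \<alpha> i) * q) \<gamma> \<noteq> 0 \<Longrightarrow> \<forall>i\<in>U. \<alpha> i \<le> \<gamma> i" if "finite U" "U \<subseteq> T" for U \<gamma>
    using that
  proof (induction U arbitrary: \<gamma>)
    case (insert j U)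
    have j: "j \<in> T" and U: "U \<subseteq> T"
      using insert.prems(2) by auto
    have "coef (f j ^ \<alpha> j * ((\<Prod>i\<in>U. f i ^ \<alpha> i) * q)) \<gamma> \<noteq> 0"
      using insert.prems(1) insert.hyps by (simp add: mult.assoc)
    hence "\<alpha> j \<le> \<gamma> j" "coef ((\<Prod>i\<in>U. f i ^ \<alpha> i) * q) (\<gamma>(j := \<gamma> j - \<alpha> j)) \<noteq> 0"
      unfolding coef_power_mult[OF j] by (auto split: if_splits)
    moreover have "\<forall>i\<in>U. \<alpha> i \<le> (\<gamma>(j := \<gamma> j - \<alpha> j)) i"
      using insert.IH[OF calculation(2) U] .
    ultimately show ?case
      using insert.hyps(2) by (auto split: if_splits)
  qed simp
  from this[OF finite_T] show ?thesis
    unfolding supported_def power_product_def by (simp add: mult.commute)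
qed

text \<open>\<open>W\<close> need not be closed under multiplication by \<open>r\<close>, so
  \<open>r * coef p \<alpha>\<close> has an expansion of its own. It only adds to the exponent
  \<open>\<alpha>\<close>, and upward closure absorbs this.\<close>

lemma is_ideal_supported:
  assumes up: "\<And>\<alpha> \<gamma>. \<alpha> \<in> A \<Longrightarrow> \<forall>i\<in>T. \<alpha> i \<le> \<gamma> i \<Longrightarrow> \<gamma> \<in> A"
  shows "is_ideal (supported A)"
proof (rule ring_ideal.subspaceI)
  fix r p assume p: "p \<in> supported A"
  have "r * coef p \<alpha> * power_product f T \<alpha> \<in> supported A" if "coef p \<alpha> \<noteq> 0" for \<alpha>
  proof -
    have "\<alpha> \<in> A"
      using p that by (auto simp: supported_def)
    thus ?thesis
      using power_product_mult_supported[of "r * coef p \<alpha>" \<alpha>]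
        supported_mono[of "{\<gamma>. \<forall>i\<in>T. \<alpha> i \<le> \<gamma> i}" A] up by blast
  qed
  moreover have "r * p = (\<Sum>\<alpha> | coef p \<alpha> \<noteq> 0. r * coef p \<alpha> * power_product f T \<alpha>)"
    by (subst expansion_coef[of p]) (simp add: sum_distrib_left mult.assoc)
  ultimately show "r * p \<in> supported A"
    using supported_sum[of "{\<alpha>. coef p \<alpha> \<noteq> 0}" "\<lambda>\<alpha>. r * coef p \<alpha> * power_product f T \<alpha>" A] by simp
qed (auto intro: supported_add supported_zero)

text \<open>The exponents of \<open>D\<close> count the factors from \<open>D\<close>: multiplying
  by a generator raises their sum by one, and a term whose sum is at least \<open>Suc k\<close> has
  a generator to split off.\<close>

lemma ideal_power_supported:
  assumes "D \<subseteq> T"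
  shows "ideal_power (ideal_gen (f ` D)) k = supported {\<gamma>. k \<le> (\<Sum>i\<in>D. \<gamma> i)}"
proof (induction k)
  case 0
  show ?case
    by (simp add: supported_def)
next
  case (Suc k)
  define A where "A k = {\<gamma> :: 'i \<Rightarrow> nat. k \<le> (\<Sum>i\<in>D. \<gamma> i)}" for k
  have finD: "finite D"
    using assms finite_T finite_subset by blast
  have sum_le: "(\<Sum>i\<in>D. \<alpha> i) \<le> (\<Sum>i\<in>D. \<gamma> i)" if "\<forall>i\<in>T. \<alpha> i \<le> \<gamma> i" for \<alpha> \<gamma> :: "'i \<Rightarrow> nat"
    using that assms by (intro sum_mono) auto
  have up: "is_ideal (supported (A k))" for k
  proof (rule is_ideal_supported)
    show "\<gamma> \<in> A k" if "\<alpha> \<in> A k" "\<forall>i\<in>T. \<alpha> i \<le> \<gamma> i" for \<alpha> \<gamma>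
      using sum_le[OF that(2)] that(1) by (simp add: A_def)
  qed
  have sum_split: "(\<Sum>i\<in>D. \<gamma> i) = \<gamma> j + (\<Sum>i\<in>D - {j}. \<gamma> i)" if "j \<in> D" for \<gamma> :: "'i \<Rightarrow> nat" and j
    using sum.remove[OF finD that] .
  have "ideal_times (ideal_gen (f ` D)) (supported (A k)) \<subseteq> supported (A (Suc k))"
    unfolding ideal_times_def
  proof (intro ring_ideal.span_minimal[OF _ up] subsetI)
    fix x assume "x \<in> {p * q | p q. p \<in> ideal_gen (f ` D) \<and> q \<in> supported (A k)}"
    then obtain p q where x: "x = p * q" and p: "p \<in> ideal_gen (f ` D)" and q: "q \<in> supported (A k)"
      by blast
    \<comment> \<open>For fixed \<open>q\<close> the admissible \<open>p\<close> form an ideal, so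
      only the generators \<open>f j\<close> have to be checked.\<close>
    have "f ` D \<subseteq> {p. p * q \<in> supported (A (Suc k))}"
    proof safe
      fix j assume j: "j \<in> D"
      show "f j * q \<in> supported (A (Suc k))"
        unfolding supported_def
      proof safe
        fix \<alpha> assume "coef (f j * q) \<alpha> \<noteq> 0"
        hence "\<alpha> j \<noteq> 0" "\<alpha>(j := \<alpha> j - 1) \<in> A k"
          using coef_mult[of j q \<alpha>] j assms q by (auto simp: supported_def split: if_splits)
        thus "\<alpha> \<in> A (Suc k)"
          unfolding A_def by (simp add: sum_split[OF j] cong: sum.cong_simp)
      qed
    qed
    moreover have "is_ideal {p. p * q \<in> supported (A (Suc k))}"
      using up[of "Suc k"] by (auto simp: ring_ideal.subspace_def distrib_right mult.assoc)
    ultimately show "x \<in> supported (A (Suc k))"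
      using ring_ideal.span_minimal p x by blast
  qed
  moreover have "supported (A (Suc k)) \<subseteq> ideal_times (ideal_gen (f ` D)) (supported (A k))"
  proof
    fix p assume p: "p \<in> supported (A (Suc k))"
    have "coef p \<alpha> * power_product f T \<alpha> \<in> ideal_times (ideal_gen (f ` D)) (supported (A k))"
      if "coef p \<alpha> \<noteq> 0" for \<alpha>
    proof -
      have "Suc k \<le> (\<Sum>i\<in>D. \<alpha> i)"
        using p that by (auto simp: supported_def A_def)
      then obtain j where j: "j \<in> D" "\<alpha> j \<noteq> 0"
        by (metis Suc_le_eq finD gr_zeroI less_nat_zero_code sum_eq_0_iff)
      define \<beta> where "\<beta> = \<alpha>(j := \<alpha> j - 1)"
      have "\<alpha> = \<beta>(j := Suc (\<beta> j))"
        using j(2) by (auto simp: \<beta>_def)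
      hence pp: "power_product f T \<alpha> = f j * power_product f T \<beta>"
        using power_product_Suc[OF finite_T, where i = j and \<alpha> = \<beta>] j(1) assms by auto
      have "\<beta> \<in> A k"
        using \<open>Suc k \<le> (\<Sum>i\<in>D. \<alpha> i)\<close> j(2) unfolding A_def \<beta>_def
        by (simp add: sum_split[OF j(1)] cong: sum.cong_simp)
      hence "{\<gamma>. \<forall>i\<in>T. \<beta> i \<le> \<gamma> i} \<subseteq> A k"
        using sum_le[of \<beta>] unfolding A_def by (auto intro: order_trans)
      hence "coef p \<alpha> * power_product f T \<beta> \<in> supported (A k)"
        using power_product_mult_supported[of "coef p \<alpha>" \<beta>] supported_mono by blast
      moreover have "f j \<in> ideal_gen (f ` D)"
        using j(1) by (auto intro: ring_ideal.span_base)
      ultimately have "f j * (coef p \<alpha> * power_product f T \<beta>)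
          \<in> ideal_times (ideal_gen (f ` D)) (supported (A k))"
        unfolding ideal_times_def by (auto intro!: ring_ideal.span_base)
      thus ?thesis
        by (simp add: pp mult.left_commute)
    qed
    hence "(\<Sum>\<alpha> | coef p \<alpha> \<noteq> 0. coef p \<alpha> * power_product f T \<alpha>)
        \<in> ideal_times (ideal_gen (f ` D)) (supported (A k))"
      unfolding ideal_times_def by (intro ring_ideal.span_sum) auto
    thus "p \<in> ideal_times (ideal_gen (f ` D)) (supported (A k))"
      using expansion_coef[of p] by simp
  qed
  ultimately show ?case
    using Suc.IH by (simp add: A_def)
qed

text \<open>Multiplying by a power of \<open>f j\<close> shifts only the exponent of
  \<open>j\<close>, which is outside \<open>D\<close>; the sum over \<open>D\<close> that decides
  membership does not change.\<close>

lemma ideal_power_nonzerodivisor: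
  assumes "D \<subseteq> T" "j \<in> T - D" and "f j ^ l * p \<in> ideal_power (ideal_gen (f ` D)) k"
  shows "p \<in> ideal_power (ideal_gen (f ` D)) k"
  unfolding ideal_power_supported[OF assms(1)] supported_def
proof safe
  fix \<alpha> assume "coef p \<alpha> \<noteq> 0"
  hence "coef (f j ^ l * p) (\<alpha>(j := \<alpha> j + l)) \<noteq> 0"
    using assms(2) by (simp add: coef_power_mult)
  hence "k \<le> (\<Sum>i\<in>D. (\<alpha>(j := \<alpha> j + l)) i)"
    using assms(3) unfolding ideal_power_supported[OF assms(1)] supported_def by blast
  also have "\<dots> = (\<Sum>i\<in>D. \<alpha> i)"
    using assms(2) by (intro sum.cong) auto
  finally show "k \<le> (\<Sum>i\<in>D. \<alpha> i)" .
qed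

end


section \<open>Graded complements\<close>

definition monomial :: "('x::finite \<Rightarrow>\<^sub>0 nat) \<Rightarrow> ('x, 'k::field) mpoly_ring"
  where "monomial e = Poly_Mapping.single e 1"

definition scalar_mult :: "'k::field \<Rightarrow> ('x::finite, 'k) mpoly_ring \<Rightarrow> ('x, 'k) mpoly_ring"
  where "scalar_mult c p = Poly_Mapping.single 0 c * p"

interpretation poly_space: vector_space scalar_mult
  by unfold_locales
    (simp_all add: scalar_mult_def single_add distrib_left distrib_right mult_single
      flip: mult.assoc)

lemma scalar_mult_monomial: "scalar_mult c (monomial e) = Poly_Mapping.single e c"
  by (simp add: scalar_mult_def monomial_def mult_single)

lemma monomial_add: "monomial (d + e) = monomial d * monomial e"
  by (simp add: monomial_def mult_single)

lemma monomial_zero: "monomial 0 = 1"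
  by (simp add: monomial_def)

lemma polynomial_sum_monomials: "p = (\<Sum>e\<in>Poly_Mapping.keys p. scalar_mult (Poly_Mapping.lookup p e) (monomial e))"
  by (rule poly_mapping_eqI)
    (simp add: scalar_mult_monomial lookup_sum lookup_single when_def in_keys_iff)

lemma in_span_monomials: "Poly_Mapping.keys p \<subseteq> M \<Longrightarrow> p \<in> poly_space.span (monomial ` M)"
  by (subst polynomial_sum_monomials[of p])
    (auto intro: poly_space.span_sum[OF poly_space.span_scale[OF poly_space.span_base]])

section \<open>Degrees and homogeneous parts\<close>

lemma total_degree_add: "total_degree (d + e) = total_degree d + total_degree e"
  by (simp add: total_degree_def lookup_add sum.distrib)

lemma total_degree_zero: "total_degree 0 = 0"
  by (simp add: total_degree_def)

lemma homogeneous_mult: "homogeneous c p \<Longrightarrow> homogeneous d q \<Longrightarrow> homogeneous (c + d) (p * q)"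
  using keys_mult[of p q] by (fastforce simp: homogeneous_def total_degree_add)

lemma homogeneous_one: "homogeneous 0 1"
  by (simp add: homogeneous_def total_degree_zero)

lemma homogeneous_power: "homogeneous d p \<Longrightarrow> homogeneous (k * d) (p ^ k)"
  by (induction k) (auto simp: homogeneous_one intro: homogeneous_mult)

lemma homogeneous_prod:
  "(\<And>i. i \<in> S \<Longrightarrow> homogeneous (d i) (g i)) \<Longrightarrow> homogeneous (\<Sum>i\<in>S. d i) (\<Prod>i\<in>S. g i)"
  by (induction S rule: infinite_finite_induct) (auto simp: homogeneous_one intro: homogeneous_mult)

lemma homogeneous_monomial: "homogeneous (total_degree e) (monomial e)"
  by (simp add: homogeneous_def monomial_def)

lift_definition homogeneous_part :: "nat \<Rightarrow> ('x::finite, 'k::field) mpoly_ring \<Rightarrow> ('x, 'k) mpoly_ring"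
  is "\<lambda>d p e. if total_degree e = d then p e else 0"
  by (auto elim: rev_finite_subset)

lemma homogeneous_part_zero: "homogeneous_part d 0 = 0"
  by transfer auto

lemma homogeneous_part_add: "homogeneous_part d (p + q) = homogeneous_part d p + homogeneous_part d q"
  by transfer auto

lemma homogeneous_part_sum: "homogeneous_part d (\<Sum>i\<in>S. g i) = (\<Sum>i\<in>S. homogeneous_part d (g i))"
  by (induction S rule: infinite_finite_induct)
    (simp_all add: homogeneous_part_zero homogeneous_part_add)

lemma homogeneous_part_homogeneous:
  "homogeneous c p \<Longrightarrow> homogeneous_part d p = (if c = d then p else 0)"
  by (rule poly_mapping_eqI) (auto simp: homogeneous_part.rep_eq homogeneous_def in_keys_iff)

lemma homogeneous_homogeneous_part: "homogeneous d (homogeneous_part d p)"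
  by (auto simp: homogeneous_def homogeneous_part.rep_eq in_keys_iff split: if_splits)

lemma homogeneous_part_mult:
  assumes "homogeneous c f"
  shows "homogeneous_part d (f * q) = (if c \<le> d then f * homogeneous_part (d - c) q else 0)"
proof -
  have scaled: "homogeneous (total_degree e) (scalar_mult a (monomial e))" for a :: 'b and e :: "'a \<Rightarrow>\<^sub>0 nat"
    by (simp add: homogeneous_def scalar_mult_monomial)
  have "homogeneous_part d (f * q)
      = (\<Sum>e\<in>Poly_Mapping.keys q. homogeneous_part d (f * scalar_mult (Poly_Mapping.lookup q e) (monomial e)))"
    by (subst polynomial_sum_monomials[of q]) (simp add: sum_distrib_left homogeneous_part_sum)
  also have "\<dots> = (\<Sum>e\<in>Poly_Mapping.keys q. if c \<le> d then f * homogeneous_part (d - c) (scalar_mult (Poly_Mapping.lookup q e) (monomial e)) else 0)"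
    by (intro sum.cong)
      (auto simp: homogeneous_part_homogeneous[OF homogeneous_mult[OF assms scaled]]
        homogeneous_part_homogeneous[OF scaled])
  also have "\<dots> = (if c \<le> d then f * homogeneous_part (d - c) q else 0)"
  proof -
    have "homogeneous_part (d - c) q
        = (\<Sum>e\<in>Poly_Mapping.keys q. homogeneous_part (d - c) (scalar_mult (Poly_Mapping.lookup q e) (monomial e)))"
      by (subst polynomial_sum_monomials[of q]) (rule homogeneous_part_sum)
    thus ?thesis
      by (simp add: sum_distrib_left)
  qed
  finally show ?thesis .
qed

lemma sum_homogeneous_parts: "\<exists>N. p = (\<Sum>d<N. homogeneous_part d p)"
proof
  define N where "N = Suc (Max (insert 0 (total_degree ` Poly_Mapping.keys p)))"
  have "total_degree e < N" if "e \<in> Poly_Mapping.keys p" for e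
    using that by (auto simp: N_def less_Suc_eq_le)
  thus "p = (\<Sum>d<N. homogeneous_part d p)"
    by (intro poly_mapping_eqI) (auto simp: lookup_sum homogeneous_part.rep_eq in_keys_iff)
qed

lemma ideal_gen_mult: "p \<in> ideal_gen A \<Longrightarrow> r * p \<in> ideal_gen A"
  by (rule ring_ideal.span_scale)

lemma subspace_ideal_gen: "poly_space.subspace (ideal_gen A)"
  by (auto intro!: poly_space.subspaceI ring_ideal.span_zero ring_ideal.span_add ideal_gen_mult
      simp: scalar_mult_def)

text \<open>A basis \<open>S\<close> of the subspace is extended to a basis \<open>B\<close> of the
  whole space by monomials only. The added monomials span a complement, which is thereby closed
  under taking homogeneous parts.\<close>

lemma monomial_complement:
  assumes "poly_space.subspace (I :: ('x::finite, 'k::field) mpoly_ring set)"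
  obtains M where "\<And>p. p \<in> poly_space.span (monomial ` M) \<Longrightarrow> p \<in> I \<Longrightarrow> p = 0"
    and "\<And>p. \<exists>w\<in>poly_space.span (monomial ` M). p - w \<in> I"
proof -
  obtain S where S: "S \<subseteq> I" "poly_space.independent S" "I \<subseteq> poly_space.span S"
    using poly_space.maximal_independent_subset by blast
  have spanS: "poly_space.span S = I"
    using S assms poly_space.span_minimal by blast
  obtain B where B: "S \<subseteq> B" "B \<subseteq> S \<union> range monomial" "poly_space.independent B"
      "S \<union> range monomial \<subseteq> poly_space.span B"
    using poly_space.maximal_independent_subset_extend[of S "S \<union> range monomial"] S(2) by blast
  define M where "M = {e. monomial e \<in> B - S}"
  have M: "monomial ` M = B - S"
    using B(2) by (auto simp: M_def)
  show thesis
  proof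
    fix p assume p: "p \<in> poly_space.span (monomial ` M)" "p \<in> I"
    have spanB: "p \<in> poly_space.span B"
      using p(1) poly_space.span_mono[of "B - S" B] by (auto simp: M)
    \<comment> \<open>The coordinates of \<open>p\<close> are supported both on \<open>S\<close> and
      on \<open>B - S\<close>, so they all vanish.\<close>
    have "poly_space.representation B p = poly_space.representation (B - S) p"
      using poly_space.representation_extend[OF B(3)] p(1) by (simp add: M)
    moreover have "poly_space.representation B p = poly_space.representation S p"
      using poly_space.representation_extend[OF B(3)] p(2) B(1) by (simp add: spanS)
    ultimately have "poly_space.representation B p b = 0" for b
      using poly_space.representation_ne_zero[of S p b] poly_space.representation_ne_zero[of "B - S" p b]
      by auto
    thus "p = 0"
      using poly_space.sum_nonzero_representation_eq[OF B(3) spanB] by simp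
  next
    fix p :: "('x, 'k) mpoly_ring"
    have "poly_space.span (range monomial) \<subseteq> poly_space.span B"
      using B(4) poly_space.span_minimal[of "range monomial" "poly_space.span B"] by auto
    hence "p \<in> poly_space.span (S \<union> (B - S))"
      using in_span_monomials[of p UNIV] B(1) by (auto simp: Un_absorb1)
    then obtain i w where "p = i + w" "i \<in> poly_space.span S" "w \<in> poly_space.span (B - S)"
      unfolding poly_space.span_Un by blast
    hence "p - w \<in> I" "w \<in> poly_space.span (monomial ` M)"
      by (auto simp: M spanS)
    thus "\<exists>w\<in>poly_space.span (monomial ` M). p - w \<in> I"
      by blast
  qed
qed

lemma homogeneous_part_span_monomials:
  assumes "p \<in> poly_space.span (monomial ` M)"
  shows "homogeneous_part d p \<in> poly_space.span (monomial ` M)"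
  using assms
proof (induction rule: poly_space.span_induct_alt)
  case base
  show ?case
    by (simp add: homogeneous_part_zero poly_space.span_zero)
next
  case (step c x y)
  have "homogeneous_part d (scalar_mult c x) = scalar_mult c (homogeneous_part d x)"
    unfolding scalar_mult_def
    by (subst homogeneous_part_mult[of 0]) (simp_all add: homogeneous_def total_degree_zero)
  moreover obtain e where e: "x = monomial e" "e \<in> M"
    using step by auto
  hence "homogeneous_part d x \<in> poly_space.span (monomial ` M)"
    by (auto simp: homogeneous_part_homogeneous[OF homogeneous_monomial]
        intro: poly_space.span_base poly_space.span_zero)
  ultimately show ?case
    using step by (auto simp: homogeneous_part_add intro!: poly_space.span_add poly_space.span_scale)
qed

lemma (in quasi_regular_family) expands_sum:
  assumes "\<And>x. x \<in> X \<Longrightarrow> \<exists>w. expands (g x) w"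
  shows "\<exists>w. expands (sum g X) w"
  using assms
proof (induction X rule: infinite_finite_induct)
  case (insert x X)
  then obtain v w where "expands (g x) v" "expands (sum g X) w"
    by blast
  thus ?case
    using expands_add insert.hyps by fastforce
qed (use expands_W[OF W_zero] in auto)

text \<open>Existence of expansions comes from the grading: splitting off the part in
  \<open>W\<close> leaves multiples of the \<open>f i\<close>, whose cofactors have smaller degree
  because the \<open>f i\<close> have positive degree.\<close>

lemma forms_power_decomposition:
  fixes f :: "'i \<Rightarrow> ('x::finite, 'k::field) mpoly_ring"
  assumes "finite T" "quasi_regular f T" "\<And>i. i \<in> T \<Longrightarrow> is_form (f i)"
  obtains W where "power_decomposition f T W"
proof -
  obtain M where M: "\<And>p :: ('x, 'k) mpoly_ring. p \<in> poly_space.span (monomial ` M) \<Longrightarrow> p \<in> ideal_gen (f ` T) \<Longrightarrow> p = 0"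
    and M_complement: "\<And>p :: ('x, 'k) mpoly_ring. \<exists>w\<in>poly_space.span (monomial ` M). p - w \<in> ideal_gen (f ` T)"
    using monomial_complement[OF subspace_ideal_gen] by blast
  define W :: "('x, 'k) mpoly_ring set" where "W = poly_space.span (monomial ` M)"
  interpret quasi_regular_family f T W
    by unfold_locales
      (use assms M in \<open>auto simp: W_def intro: poly_space.span_zero poly_space.span_diff\<close>)
  have expands_homogeneous: "\<exists>w. expands p w" if "homogeneous d p" for d p
    using that
  proof (induction d arbitrary: p rule: less_induct)
    case (less d)
    \<comment> \<open>Taking the part of degree \<open>d\<close> turns a summand
      \<open>f i * c\<close> into \<open>f i\<close> times the part of \<open>c\<close> of degree
      \<open>d - \<delta>\<close>, where the induction hypothesis applies, or into 0 if
      \<open>\<delta> > d\<close>.\<close>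
    have ideal: "\<exists>v. expands (homogeneous_part d x) v" if "x \<in> ideal_gen (f ` T)" for x
      using that
    proof (induction rule: ring_ideal.span_induct_alt)
      case base
      show ?case
        using expands_W[OF W_zero] by (auto simp: homogeneous_part_zero)
    next
      case (step c x y)
      then obtain i where i: "i \<in> T" "x = f i"
        by auto
      obtain \<delta> where \<delta>: "\<delta> > 0" "homogeneous \<delta> (f i)"
        using assms(3)[OF i(1)] unfolding is_form_def by blast
      have "\<exists>v. expands (homogeneous_part d (f i * c)) v"
      proof (cases "\<delta> \<le> d")
        case True
        then obtain v where "expands (homogeneous_part (d - \<delta>) c) v"
          using less.IH[of "d - \<delta>"] \<delta>(1) homogeneous_homogeneous_part by fastforce
        thus ?thesis
          using expands_mult i(1) True by (auto simp: homogeneous_part_mult[OF \<delta>(2)])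
      qed (use expands_W[OF W_zero] in \<open>auto simp: homogeneous_part_mult[OF \<delta>(2)]\<close>)
      thus ?case
        using step(2) expands_add unfolding i(2) homogeneous_part_add mult.commute[of c] by blast
    qed
    obtain w where w: "w \<in> W" "p - w \<in> ideal_gen (f ` T)"
      using M_complement by (auto simp: W_def)
    have "homogeneous_part d w \<in> W"
      using w(1) homogeneous_part_span_monomials by (simp add: W_def)
    moreover obtain v where "expands (homogeneous_part d (p - w)) v"
      using ideal[OF w(2)] by blast
    ultimately have "\<exists>v. expands (homogeneous_part d w + homogeneous_part d (p - w)) v"
      using expands_add expands_W by blast
    moreover have "homogeneous_part d w + homogeneous_part d (p - w) = p"
      using homogeneous_part_homogeneous[OF less.prems, of d]
      by (simp flip: homogeneous_part_add)
    ultimately show ?case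
      by (simp only:)
  qed
  have "\<exists>w. expands p w" for p
  proof -
    obtain N where "p = (\<Sum>d<N. homogeneous_part d p)"
      using sum_homogeneous_parts by blast
    moreover have "\<exists>w. expands (\<Sum>d<N. homogeneous_part d p) w"
      by (rule expands_sum[OF expands_homogeneous[OF homogeneous_homogeneous_part]])
    ultimately show ?thesis
      by metis
  qed
  hence "power_decomposition f T W"
    by unfold_locales
  thus thesis
    by (rule that)
qed

text \<open>All exponents but the one of \<open>x0\<close> determine a monomial of degree
  \<open>d\<close>, and each is at most \<open>d\<close>. What matters is that the bound grows in
  \<open>d\<close> with one power less than the number of variables.\<close>

lemma monomials_of_degree_card:
  fixes d :: nat
  defines "M \<equiv> {e :: 'x::finite \<Rightarrow>\<^sub>0 nat. total_degree e = d}"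
  shows "finite M" "card M \<le> (d + 1) ^ (CARD('x) - 1)"
proof -
  fix x0 :: 'x
  have total: "total_degree e = Poly_Mapping.lookup e x0 + (\<Sum>x\<in>UNIV - {x0}. Poly_Mapping.lookup e x)" for e :: "'x \<Rightarrow>\<^sub>0 nat"
    unfolding total_degree_def by (simp add: sum.remove[of UNIV x0])
  define \<rho> where "\<rho> e = restrict (Poly_Mapping.lookup e) (UNIV - {x0})" for e :: "'x \<Rightarrow>\<^sub>0 nat"
  have inj: "inj_on \<rho> M"
  proof (rule inj_onI)
    fix e e' assume "e \<in> M" "e' \<in> M" and eq: "\<rho> e = \<rho> e'"
    have rest: "Poly_Mapping.lookup e x = Poly_Mapping.lookup e' x" if "x \<noteq> x0" for x
      using fun_cong[OF eq, of x] that by (simp add: \<rho>_def)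
    hence "(\<Sum>x\<in>UNIV - {x0}. Poly_Mapping.lookup e x) = (\<Sum>x\<in>UNIV - {x0}. Poly_Mapping.lookup e' x)"
      by (intro sum.cong) auto
    hence "Poly_Mapping.lookup e x0 = Poly_Mapping.lookup e' x0"
      using \<open>e \<in> M\<close> \<open>e' \<in> M\<close> total[of e] total[of e'] by (simp add: M_def)
    thus "e = e'"
      using rest by (intro poly_mapping_eqI) metis
  qed
  have le: "Poly_Mapping.lookup e x \<le> d" if "e \<in> M" for e x
    using that member_le_sum[of x UNIV "Poly_Mapping.lookup e"] by (auto simp: M_def total_degree_def)
  have sub: "\<rho> ` M \<subseteq> PiE (UNIV - {x0}) (\<lambda>_. {..d})"
    using le unfolding \<rho>_def by (intro image_subsetI) (simp only: restrict_PiE_iff atMost_iff Ball_def simp_thms)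
  have fin: "finite (PiE (UNIV - {x0}) (\<lambda>_. {..d}))"
    by (intro finite_PiE) auto
  show "finite M"
    using finite_imageD[OF finite_subset[OF sub fin] inj] .
  have "card M \<le> card (PiE (UNIV - {x0}) (\<lambda>_. {..d}))"
    using card_inj_on_le[OF inj sub fin] .
  thus "card M \<le> (d + 1) ^ (CARD('x) - 1)"
    by (simp add: card_PiE)
qed


section \<open>Systems of parameters and saturation\<close>

text \<open>
  If no power of the maximal ideal lay in the ideal, then for every power product in the forms
  there would be a monomial outside the ideal completing it to a given degree. Quasi-regularity
  makes these completed products linearly independent, and there are more of them than
  monomials of that degree.
\<close>

lemma quasi_regular_forms_primary:
  fixes f :: "'i \<Rightarrow> ('x::finite, 'k::field) mpoly_ring"
  assumes "finite T" "quasi_regular f T" "\<And>i. i \<in> T \<Longrightarrow> is_form (f i)" "card T = CARD('x)"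
  shows "\<exists>k. \<forall>e. total_degree e = k \<longrightarrow> monomial e \<in> ideal_gen (f ` T)"
proof (rule ccontr)
  assume "\<nexists>k. \<forall>e. total_degree e = k \<longrightarrow> (monomial e :: ('x, 'k) mpoly_ring) \<in> ideal_gen (f ` T)"
  then obtain u where u: "\<And>k. total_degree (u k) = k"
      "\<And>k. (monomial (u k) :: ('x, 'k) mpoly_ring) \<notin> ideal_gen (f ` T)"
    by metis
  obtain \<delta> where \<delta>: "\<And>i. i \<in> T \<Longrightarrow> \<delta> i > 0" "\<And>i. i \<in> T \<Longrightarrow> homogeneous (\<delta> i) (f i)"
    using assms(3) unfolding is_form_def by metis
  define N where "N = CARD('x)"
  define E where "E = (\<Sum>i\<in>T. \<delta> i)"
  \<comment> \<open>This choice gives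
    \<open>((q + 1) * E) ^ (N - 1) = (q + 1) ^ (N - 1) * q\<close>, which is less than the number
    \<open>(q + 1) ^ N\<close> of power products with exponents up to \<open>q\<close>. The degree
    \<open>d\<close> bounds the degrees of all of them.\<close>
  define q where "q = E ^ (N - 1)"
  define d where "d = q * E"
  have N: "N > 0"
    by (simp add: N_def)
  obtain i where "i \<in> T"
    using assms(4) N unfolding N_def by fastforce
  hence E: "E > 0"
    using \<delta>(1)[of i] member_le_sum[of i T \<delta>] assms(1) by (simp add: E_def)
  \<comment> \<open>Functions in \<open>PiE\<close> are \<open>undefined\<close> off
    \<open>T\<close>; exponent vectors must be 0 there.\<close>
  define ext where "ext g i = (if i \<in> T then g i else 0)" for g :: "'i \<Rightarrow> nat" and i
  define X where "X = ext ` PiE T (\<lambda>_. {..q})"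
  define deg where "deg \<alpha> = (\<Sum>i\<in>T. \<alpha> i * \<delta> i)" for \<alpha>
  define \<phi> where "\<phi> \<alpha> = monomial (u (d - deg \<alpha>)) * power_product f T \<alpha>" for \<alpha>
  define M where "M = {e :: 'x \<Rightarrow>\<^sub>0 nat. total_degree e = d}"
  have "inj_on ext (PiE T (\<lambda>_. {..q}))"
  proof (rule inj_onI)
    fix g h assume g: "g \<in> PiE T (\<lambda>_. {..q})" "h \<in> PiE T (\<lambda>_. {..q})" and eq: "ext g = ext h"
    show "g = h"
    proof (rule PiE_ext[OF g])
      show "g i = h i" if "i \<in> T" for i
        using fun_cong[OF eq, of i] that by (simp add: ext_def)
    qed
  qed
  hence card_X: "card X = (q + 1) ^ N"
    using assms(1,4) by (simp add: X_def card_image card_PiE N_def)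
  have fin_X: "finite X"
    unfolding X_def using assms(1) by (intro finite_imageI finite_PiE) auto
  have X_exp: "X \<subseteq> exponents T"
    by (auto simp: X_def ext_def exponents_def)
  have deg_le: "deg \<alpha> \<le> d" if "\<alpha> \<in> X" for \<alpha>
  proof -
    have "\<alpha> i \<le> q" if "i \<in> T" for i
      using \<open>\<alpha> \<in> X\<close> that by (auto simp: X_def ext_def)
    thus ?thesis
      unfolding deg_def d_def E_def sum_distrib_left by (intro sum_mono mult_right_mono) auto
  qed
  have \<phi>_span: "\<phi> \<alpha> \<in> poly_space.span (monomial ` M)" if "\<alpha> \<in> X" for \<alpha>
  proof -
    have "homogeneous (d - deg \<alpha> + deg \<alpha>) (\<phi> \<alpha>)"
      unfolding \<phi>_def deg_def power_product_def
      by (intro homogeneous_mult homogeneous_prod homogeneous_power \<delta>)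
        (use homogeneous_monomial[of "u (d - deg \<alpha>)"] u(1) in \<open>simp_all add: deg_def\<close>)
    thus ?thesis
      using deg_le[OF that] by (intro in_span_monomials) (auto simp: homogeneous_def M_def)
  qed
  have zero: "c \<alpha> = 0" if "\<alpha> \<in> X" "(\<Sum>\<alpha>\<in>X. scalar_mult (c \<alpha>) (\<phi> \<alpha>)) = 0" for c \<alpha>
  proof -
    define w :: "('i \<Rightarrow> nat) \<Rightarrow> ('x, 'k) mpoly_ring"
      where "w \<alpha> = scalar_mult (c \<alpha>) (monomial (u (d - deg \<alpha>)))" for \<alpha>
    \<comment> \<open>A nonzero scalar could be inverted, which would put the monomial
      \<open>u (d - deg \<beta>)\<close> into the ideal.\<close>
    have "w \<beta> = 0" if "w \<beta> \<in> ideal_gen (f ` T)" for \<beta>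
    proof (rule ccontr)
      assume "w \<beta> \<noteq> 0"
      hence c: "c \<beta> \<noteq> 0"
        by (auto simp: w_def)
      have "scalar_mult (inverse (c \<beta>)) (w \<beta>) \<in> ideal_gen (f ` T)"
        unfolding scalar_mult_def using that by (rule ideal_gen_mult)
      thus False
        using c u(2) by (simp add: w_def)
    qed
    moreover have "(\<Sum>\<alpha>\<in>X. w \<alpha> * power_product f T \<alpha>) = 0"
      using that(2) by (simp add: w_def \<phi>_def scalar_mult_def mult.assoc)
    ultimately have "\<forall>\<alpha>\<in>X. w \<alpha> = 0"
      using assms(2) fin_X X_exp unfolding quasi_regular_def by blast
    hence "Poly_Mapping.single (u (d - deg \<alpha>)) (c \<alpha>) = 0"
      using that(1) unfolding w_def scalar_mult_monomial by blast
    thus ?thesis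
      using lookup_single_eq[of "u (d - deg \<alpha>)" "c \<alpha>"] by simp
  qed
  \<comment> \<open>Equal products at different exponents would be a relation with coefficients 1
    and -1. Injectivity is what lets the products be counted by \<open>X\<close>.\<close>
  have inj: "inj_on \<phi> X"
  proof (rule inj_onI, rule ccontr)
    fix \<alpha> \<beta> assume ab: "\<alpha> \<in> X" "\<beta> \<in> X" and eq: "\<phi> \<alpha> = \<phi> \<beta>" and ne: "\<alpha> \<noteq> \<beta>"
    define c :: "('i \<Rightarrow> nat) \<Rightarrow> 'k" where "c \<gamma> = (if \<gamma> = \<alpha> then 1 else if \<gamma> = \<beta> then -1 else 0)" for \<gamma>
    have "(\<Sum>\<gamma>\<in>X. scalar_mult (c \<gamma>) (\<phi> \<gamma>)) = (\<Sum>\<gamma>\<in>{\<alpha>, \<beta>}. scalar_mult (c \<gamma>) (\<phi> \<gamma>))"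
      by (rule sum.mono_neutral_right) (use ab fin_X in \<open>auto simp: c_def\<close>)
    also have "\<dots> = 0"
      using ne eq by (simp add: c_def)
    finally have "c \<alpha> = 0"
      using zero ab(1) by blast
    thus False
      by (simp add: c_def)
  qed
  have "poly_space.independent (\<phi> ` X)"
  proof (rule poly_space.independent_if_scalars_zero)
    fix c x assume sum: "(\<Sum>x\<in>\<phi> ` X. scalar_mult (c x) x) = 0" and "x \<in> \<phi> ` X"
    then obtain \<alpha> where "\<alpha> \<in> X" "x = \<phi> \<alpha>"
      by blast
    thus "c x = 0"
      using zero[of \<alpha> "\<lambda>\<alpha>. c (\<phi> \<alpha>)"] sum sum.reindex[OF inj, of "\<lambda>x. scalar_mult (c x) x"] by simp
  qed (use fin_X in simp)
  moreover have "\<phi> ` X \<subseteq> poly_space.span (monomial ` M)"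
    using \<phi>_span by blast
  moreover have fin_M: "finite M" and card_M: "card M \<le> (d + 1) ^ (N - 1)"
    using monomials_of_degree_card[where 'x = 'x, of d] by (simp_all add: M_def N_def)
  ultimately have "card (\<phi> ` X) \<le> card (monomial ` M :: ('x, 'k) mpoly_ring set)"
    using poly_space.independent_span_bound by blast
  also have "card (\<phi> ` X) = (q + 1) ^ N"
    by (simp only: card_image[OF inj] card_X)
  also have "card (monomial ` M :: ('x, 'k) mpoly_ring set) \<le> card M"
    by (rule card_image_le[OF fin_M])
  also note card_M
  \<comment> \<open>Here \<open>q * E + 1 \<le> (q + 1) * E\<close> because \<open>E\<close> is
    positive.\<close>
  also have "(d + 1) ^ (N - 1) \<le> ((q + 1) * E) ^ (N - 1)"
    using E by (intro power_mono) (simp_all add: d_def)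
  also have "\<dots> = (q + 1) ^ (N - 1) * q"
    by (simp only: power_mult_distrib q_def)
  also have "\<dots> < (q + 1) ^ (N - 1) * (q + 1)"
    by (intro mult_strict_left_mono) simp_all
  also have "\<dots> = (q + 1) ^ N"
    by (rule power_minus_mult[OF N])
  finally show False
    by (simp only: less_irrefl)
qed

section \<open>Powers of the graded maximal ideal\<close>

lemma ideal_times_gen: "ideal_times (ideal_gen A) (ideal_gen B) = ideal_gen {a * b | a b. a \<in> A \<and> b \<in> B}"
  (is "_ = ideal_gen ?P")
proof
  show "ideal_gen ?P \<subseteq> ideal_times (ideal_gen A) (ideal_gen B)"
    unfolding ideal_times_def by (rule ring_ideal.span_mono) (auto intro: ring_ideal.span_base)
  have "p * q \<in> ideal_gen ?P" if p: "p \<in> ideal_gen A" and q: "q \<in> ideal_gen B" for p q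
  proof -
    have "a * q \<in> ideal_gen ?P" if a: "a \<in> A" for a
    proof -
      have "is_ideal {x. a * x \<in> ideal_gen ?P}"
        by (rule ring_ideal.subspaceI)
          (auto intro: ring_ideal.span_zero ring_ideal.span_add ring_ideal.span_scale
            simp: distrib_left mult.left_commute[of a])
      moreover have "B \<subseteq> {x. a * x \<in> ideal_gen ?P}"
        using a by (auto intro: ring_ideal.span_base)
      ultimately show ?thesis
        using q ring_ideal.span_minimal by blast
    qed
    hence "A \<subseteq> {x. x * q \<in> ideal_gen ?P}"
      by blast
    moreover have "is_ideal {x. x * q \<in> ideal_gen ?P}"
      by (rule ring_ideal.subspaceI)
        (auto intro: ring_ideal.span_zero ring_ideal.span_add ring_ideal.span_scale
          simp: distrib_right mult.assoc)
    ultimately show ?thesis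
      using p ring_ideal.span_minimal by blast
  qed
  thus "ideal_times (ideal_gen A) (ideal_gen B) \<subseteq> ideal_gen ?P"
    unfolding ideal_times_def by (intro ring_ideal.span_minimal) auto
qed

lemma ideal_gen_unit: "ideal_gen {1} = UNIV"
proof -
  have "p \<in> ideal_gen {1}" for p :: 'a
    using ring_ideal.span_scale[OF ring_ideal.span_base[of 1 "{1}"], of p] by simp
  thus ?thesis
    by blast
qed

lemma total_degree_single: "total_degree (Poly_Mapping.single x k) = k"
  by (simp add: total_degree_def lookup_single when_def)

lemma exponent_split_variable:
  assumes "total_degree e > 0"
  obtains x e' where "e = Poly_Mapping.single x 1 + e'"
proof -
  obtain x where x: "Poly_Mapping.lookup e x > 0"
    using assms unfolding total_degree_def by (metis gr0I less_numeral_extra(3) sum.neutral)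
  have "e = Poly_Mapping.single x 1 + (e - Poly_Mapping.single x 1)"
    using x by (intro poly_mapping_eqI) (auto simp: lookup_add lookup_minus lookup_single when_def)
  thus thesis
    by (rule that)
qed

lemma exponent_split:
  assumes "k \<le> total_degree e"
  obtains d e' where "e = d + e'" "total_degree d = k"
proof -
  have "\<exists>d e'. e = d + e' \<and> total_degree d = k"
    using assms
  proof (induction k)
    case (Suc k)
    then obtain d e' where e: "e = d + e'" "total_degree d = k"
      by auto
    then obtain x e'' where "e' = Poly_Mapping.single x 1 + e''"
      using Suc.prems exponent_split_variable[of e'] by (auto simp: total_degree_add)
    hence "e = (d + Poly_Mapping.single x 1) + e''" "total_degree (d + Poly_Mapping.single x 1) = Suc k"
      using e by (simp_all add: add.assoc total_degree_add total_degree_single)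
    thus ?case
      by blast
  qed (auto simp: total_degree_zero intro: exI[of _ 0])
  thus thesis
    using that by blast
qed

lemma graded_max_ideal_power:
  "ideal_power graded_max_ideal k = ideal_gen (monomial ` {e. total_degree e = k})"
proof (induction k)
  case 0
  have "monomial 0 \<in> monomial ` {e :: 'a \<Rightarrow>\<^sub>0 nat. total_degree e = 0}"
    by (simp add: total_degree_zero)
  hence "ideal_gen {1 :: ('a, 'b) mpoly_ring} \<subseteq> ideal_gen (monomial ` {e. total_degree e = 0})"
    by (intro ring_ideal.span_mono) (simp add: monomial_zero)
  thus ?case
    by (auto simp: ideal_gen_unit)
next
  case (Suc k)
  have "{a * b | a b. a \<in> range variable \<and> b \<in> monomial ` {e :: 'a \<Rightarrow>\<^sub>0 nat. total_degree e = k}}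
      = (monomial ` {e. total_degree e = Suc k} :: ('a, 'b) mpoly_ring set)" (is "?L = ?R")
  proof
    have "variable x * monomial e = (monomial (Poly_Mapping.single x 1 + e) :: ('a, 'b) mpoly_ring)" for x e
      by (simp add: monomial_add) (simp add: variable_def monomial_def)
    note eq = this
    show "?L \<subseteq> ?R"
      by (auto simp: eq total_degree_add total_degree_single)
    show "?R \<subseteq> ?L"
    proof safe
      fix e :: "'a \<Rightarrow>\<^sub>0 nat" assume e: "total_degree e = Suc k"
      then obtain x e' where e': "e = Poly_Mapping.single x 1 + e'"
        using exponent_split_variable[of e] by auto
      hence "total_degree e' = k"
        using e by (simp add: total_degree_add total_degree_single)
      moreover have "(monomial e :: ('a, 'b) mpoly_ring) = variable x * monomial e'"
        by (simp only: e' eq)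
      ultimately show "\<exists>a b. (monomial e :: ('a, 'b) mpoly_ring) = a * b \<and> a \<in> range variable \<and>
          b \<in> monomial ` {e. total_degree e = k}"
        by blast
    qed
  qed
  thus ?case
    unfolding ideal_power.simps Suc.IH unfolding graded_max_ideal_def ideal_times_gen by simp
qed

lemma form_in_graded_max_ideal:
  fixes p :: "('x::finite, 'k::field) mpoly_ring"
  assumes "is_form p"
  shows "p \<in> graded_max_ideal"
proof -
  have "scalar_mult (Poly_Mapping.lookup p e) (monomial e) \<in> graded_max_ideal"
    if "e \<in> Poly_Mapping.keys p" for e
  proof -
    have "total_degree e > 0"
      using assms that by (auto simp: is_form_def homogeneous_def)
    then obtain x e' where e: "e = Poly_Mapping.single x 1 + e'"
      using exponent_split_variable by blast
    have "monomial e = monomial e' * (variable x :: ('x, 'k) mpoly_ring)"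
      by (simp add: e variable_def monomial_def mult_single add.commute)
    hence "scalar_mult (Poly_Mapping.lookup p e) (monomial e)
        = scalar_mult (Poly_Mapping.lookup p e) (monomial e') * variable x"
      by (simp add: scalar_mult_def mult.assoc)
    thus ?thesis
      unfolding graded_max_ideal_def
      using ideal_gen_mult[OF ring_ideal.span_base[OF rangeI]] by simp
  qed
  thus ?thesis
    by (subst polynomial_sum_monomials[of p]) (auto simp: graded_max_ideal_def intro: ring_ideal.span_sum)
qed

lemma form_power_in_graded_max_ideal_power:
  assumes "is_form p"
  shows "p ^ k \<in> ideal_power graded_max_ideal k"
proof (induction k)
  case (Suc k)
  thus ?case
    using form_in_graded_max_ideal[OF assms]
    unfolding ideal_power.simps power_Suc ideal_times_def by (auto intro!: ring_ideal.span_base)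
qed simp

section \<open>Saturation tested on monomials\<close>

lemma multiples_ideal: "is_ideal I \<Longrightarrow> is_ideal {x. p * x \<in> I}"
  by (auto simp: ring_ideal.subspace_def distrib_left mult.left_commute[of p])

text \<open>Monomials of degree \<open>k\<close> generate the \<open>k\<close>-th power of the
  maximal ideal. Asking for all degrees from \<open>k\<close> on makes the condition monotone in
  \<open>k\<close>, so that bounds can be enlarged freely.\<close>

lemma saturation_iff:
  assumes "is_ideal I"
  shows "p \<in> saturation I \<longleftrightarrow> (\<exists>k. \<forall>e. k \<le> total_degree e \<longrightarrow> p * monomial e \<in> I)"
proof
  assume "p \<in> saturation I"
  then obtain k where k: "\<And>q. q \<in> ideal_power graded_max_ideal k \<Longrightarrow> p * q \<in> I"
    unfolding saturation_def ideal_colon_def by blast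
  have "p * monomial e \<in> I" if "k \<le> total_degree e" for e
  proof -
    obtain d e' where e: "e = d + e'" "total_degree d = k"
      using exponent_split[OF \<open>k \<le> total_degree e\<close>] by blast
    hence "monomial e' * monomial d \<in> ideal_power graded_max_ideal k"
      unfolding graded_max_ideal_power by (auto intro: ideal_gen_mult[OF ring_ideal.span_base])
    hence "monomial e \<in> ideal_power graded_max_ideal k"
      by (simp only: e(1) monomial_add mult.commute)
    thus ?thesis
      by (rule k)
  qed
  thus "\<exists>k. \<forall>e. k \<le> total_degree e \<longrightarrow> p * monomial e \<in> I"
    by blast
next
  assume "\<exists>k. \<forall>e. k \<le> total_degree e \<longrightarrow> p * monomial e \<in> I"
  then obtain k where k: "\<And>e. k \<le> total_degree e \<Longrightarrow> p * monomial e \<in> I"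
    by blast
  \<comment> \<open>\<open>Suc k\<close> instead of \<open>k\<close>, since the union defining the
    saturation starts at exponent 1.\<close>
  have "ideal_gen (monomial ` {e. total_degree e = Suc k}) \<subseteq> {x. p * x \<in> I}"
    using k by (intro ring_ideal.span_minimal multiples_ideal assms) auto
  hence "p \<in> ideal_colon I (ideal_power graded_max_ideal (Suc k))"
    unfolding graded_max_ideal_power ideal_colon_def by blast
  thus "p \<in> saturation I"
    unfolding saturation_def by (intro UN_I[of "Suc k"]) auto
qed

lemma is_ideal_saturation:
  assumes "is_ideal I"
  shows "is_ideal (saturation I)"
proof (rule ring_ideal.subspaceI)
  show "0 \<in> saturation I"
    using ring_ideal.subspace_0[OF assms] by (simp add: saturation_iff[OF assms])
next
  fix p q assume "p \<in> saturation I" "q \<in> saturation I"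
  then obtain k l where "\<And>e. k \<le> total_degree e \<Longrightarrow> p * monomial e \<in> I"
      "\<And>e. l \<le> total_degree e \<Longrightarrow> q * monomial e \<in> I"
    unfolding saturation_iff[OF assms] by blast
  hence "\<forall>e. max k l \<le> total_degree e \<longrightarrow> (p + q) * monomial e \<in> I"
    using ring_ideal.subspace_add[OF assms] by (simp add: distrib_right)
  thus "p + q \<in> saturation I"
    unfolding saturation_iff[OF assms] by blast
next
  fix r p assume "p \<in> saturation I"
  thus "r * p \<in> saturation I"
    unfolding saturation_iff[OF assms] using ring_ideal.subspace_scale[OF assms]
    by (metis mult.assoc)
qed

lemma saturation_superset:
  assumes "is_ideal I"
  shows "I \<subseteq> saturation I"
  using ring_ideal.subspace_scale[OF assms] by (auto simp: saturation_iff[OF assms] mult.commute)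

text \<open>There are finitely many monomials of degree \<open>l\<close>, so their bounds have a
  common bound \<open>K\<close>; a monomial of degree at least \<open>l + K\<close> contains one of
  them with a cofactor of degree at least \<open>K\<close>.\<close>

lemma saturation_idempotent:
  assumes I: "is_ideal I" and p: "\<And>e. total_degree e = l \<Longrightarrow> p * monomial e \<in> saturation I"
  shows "p \<in> saturation I"
proof -
  obtain k where k: "\<And>e e'. total_degree e = l \<Longrightarrow> k e \<le> total_degree e' \<Longrightarrow> p * monomial e * monomial e' \<in> I"
    using p unfolding saturation_iff[OF I] by metis
  define L where "L = {e :: 'a \<Rightarrow>\<^sub>0 nat. total_degree e = l}"
  define K where "K = Max (insert 0 (k ` L))"
  have "finite L"
    unfolding L_def by (rule monomials_of_degree_card)
  hence K: "k e \<le> K" if "total_degree e = l" for e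
    using that by (auto simp: K_def L_def)
  have "p * monomial e \<in> I" if "l + K \<le> total_degree e" for e
  proof -
    have "l \<le> total_degree e"
      using that by simp
    then obtain d e' where e: "e = d + e'" "total_degree d = l"
      using exponent_split by blast
    hence "K \<le> total_degree e'"
      using that by (simp add: total_degree_add)
    hence "k d \<le> total_degree e'"
      using K[OF e(2)] by simp
    thus ?thesis
      using k[OF e(2)] by (simp add: e(1) monomial_add mult.assoc)
  qed
  thus ?thesis
    unfolding saturation_iff[OF I] by blast
qed


section \<open>Fold products\<close>

text \<open>Injectivity of \<open>f\<close> lets an enumeration of the forms be pulled back to one
  of the indices.\<close>

lemma regular_sequence_quasi_regular:
  assumes "inj_on f T" "distinct fs" "set fs = f ` T" "regular_sequence fs"
  shows "quasi_regular f T"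
proof -
  define js where "js = map (inv_into T f) fs"
  have fs: "map f js = fs"
    unfolding js_def map_map by (rule map_idI) (use assms(3) in \<open>simp add: f_inv_into_f\<close>)
  have set_js: "set js = T"
    using assms(1,3) by (simp add: js_def inv_into_image_cancel)
  have take: "f ` set (take k js) = set (take k fs)" for k
    by (simp flip: fs add: take_map)
  have nth: "f (js ! k) = fs ! k" "k < length fs" if "k < length js" for k
    using that by (simp_all flip: fs)
  have "distinct js"
    using assms(2) by (simp flip: fs add: distinct_map)
  hence "regular_family f js"
    using assms(4) nth unfolding regular_family_def regular_sequence_def take by metis
  thus ?thesis
    using regular_family_quasi_regular set_js by metis
qed

lemma generic_forms_quasi_regular:
  assumes "generic_forms n (f ` S)" "inj_on f S" "T \<subseteq> S" "finite T" "card T \<le> n + 1"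
  shows "quasi_regular f T"
proof -
  have "card (f ` T) \<le> n + 1"
    using assms(4,5) card_image_le[of T f] by simp
  then obtain fs where "distinct fs" "set fs = f ` T" "regular_sequence fs"
    using assms(1,3,4) unfolding generic_forms_def by (metis finite_imageI image_mono)
  thus ?thesis
    using regular_sequence_quasi_regular inj_on_subset[OF assms(2,3)] by metis
qed

lemma exists_smaller_with_sum:
  assumes "finite S" "a \<le> (\<Sum>i\<in>S. b i)"
  shows "\<exists>c. (\<forall>i\<in>S. c i \<le> b i) \<and> (\<Sum>i\<in>S. c i) = (a :: nat)"
  using assms
proof (induction S arbitrary: a)
  case (insert j S)
  have "a - min a (b j) \<le> (\<Sum>i\<in>S. b i)"
    using insert.prems insert.hyps by simp
  then obtain c where c: "\<forall>i\<in>S. c i \<le> b i" "(\<Sum>i\<in>S. c i) = a - min a (b j)"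
    using insert.IH by blast
  have "(\<Sum>i\<in>S. (c(j := min a (b j))) i) = (\<Sum>i\<in>S. c i)"
    using insert.hyps by (intro sum.cong) auto
  thus ?case
    using c insert.hyps by (intro exI[of _ "c(j := min a (b j))"]) auto
qed simp

text \<open>The exponents, cut down to \<open>m\<close>, can be lowered further until they sum to
  exactly \<open>a\<close>; this gives a generator that divides the product.\<close>

lemma prod_powers_in_fold_product_ideal:
  assumes "a \<le> (\<Sum>i=1..s. min (m i) (g i))"
  shows "(\<Prod>i=1..s. f i ^ g i) \<in> fold_product_ideal s f m a"
proof -
  obtain c where c: "\<forall>i\<in>{1..s}. c i \<le> min (m i) (g i)" "(\<Sum>i=1..s. c i) = a"
    using exists_smaller_with_sum[OF _ assms] by auto
  have "(\<Prod>i=1..s. f i ^ g i) = (\<Prod>i=1..s. f i ^ (g i - c i)) * (\<Prod>i=1..s. f i ^ c i)"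
    using c(1) by (auto simp flip: prod.distrib power_add intro!: prod.cong)
  moreover have "(\<Prod>i=1..s. f i ^ c i) \<in> fold_product_ideal s f m a"
    unfolding fold_product_ideal_def using c by (intro ring_ideal.span_base) auto
  ultimately show ?thesis
    unfolding fold_product_ideal_def by (simp add: ring_ideal.span_scale)
qed

lemma is_ideal_fold_product_ideal: "is_ideal (fold_product_ideal s f m a)"
  unfolding fold_product_ideal_def by (rule ring_ideal.subspace_span)

text \<open>The exponents of a generator outside \<open>D\<close> use up at most the sum of the
  \<open>m i\<close> there, so those in \<open>D\<close> sum to at least
  \<open>mu s m a D\<close>.\<close>

lemma fold_product_ideal_subset_power:
  assumes "power_decomposition f T W" and D: "D \<subseteq> T" and T: "T \<subseteq> {1..s}"
  shows "fold_product_ideal s f m a \<subseteq> ideal_power (ideal_gen (f ` D)) (mu s m a D)"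
proof -
  interpret power_decomposition f T W
    by fact
  define A where "A = {\<gamma> :: nat \<Rightarrow> nat. mu s m a D \<le> (\<Sum>i\<in>D. \<gamma> i)}"
  have up: "\<gamma> \<in> A" if "\<alpha> \<in> A" "\<forall>i\<in>T. \<alpha> i \<le> \<gamma> i" for \<alpha> \<gamma>
  proof -
    have "(\<Sum>i\<in>D. \<alpha> i) \<le> (\<Sum>i\<in>D. \<gamma> i)"
      using that(2) D by (intro sum_mono) auto
    thus ?thesis
      using that(1) by (simp add: A_def)
  qed
  have "(\<Prod>i=1..s. f i ^ e i) \<in> supported A"
    if e: "\<forall>i\<in>{1..s}. e i \<le> m i" "(\<Sum>i=1..s. e i) = a" for e
  proof -
    have "a = (\<Sum>i\<in>D. e i) + (\<Sum>i\<in>{1..s} - D. e i)"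
      using e(2) D T sum.subset_diff[of D "{1..s}" e] by auto
    moreover have "(\<Sum>i\<in>{1..s} - D. e i) \<le> (\<Sum>i\<in>{1..s} - D. m i)"
      using e(1) by (intro sum_mono) auto
    ultimately have "e \<in> A"
      by (simp add: A_def mu_def)
    hence sub: "supported {\<gamma>. \<forall>i\<in>T. e i \<le> \<gamma> i} \<subseteq> supported A"
      using up by (intro supported_mono) blast
    \<comment> \<open>The factors outside \<open>T\<close> serve as an arbitrary multiplier of the
      power product over \<open>T\<close>.\<close>
    have eq: "(\<Prod>i=1..s. f i ^ e i) = (\<Prod>i\<in>{1..s} - T. f i ^ e i) * power_product f T e"
      using T by (simp add: power_product_def prod.subset_diff)
    show ?thesis
      unfolding eq using power_product_mult_supported sub by blast
  qed
  moreover have "is_ideal (supported A)"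
    using up by (rule is_ideal_supported)
  ultimately have "fold_product_ideal s f m a \<subseteq> supported A"
    unfolding fold_product_ideal_def by (intro ring_ideal.span_minimal) auto
  thus ?thesis
    by (simp add: ideal_power_supported[OF D] A_def)
qed

text \<open>
  The exponents in the expansion of \<open>p\<close> satisfy the inequalities given by the powers that contain
  \<open>p\<close>. The one for the indices where the exponent does not reach \<open>m\<close> already shows that the
  exponents, cut down to \<open>m\<close>, add up to at least \<open>a\<close>.
\<close>

lemma power_intersection_mult_in_fold_product_ideal:
  assumes "power_decomposition f T W" and T: "T \<subseteq> {1..s}"
    and e: "\<And>i. i \<in> {1..s} - T \<Longrightarrow> m i \<le> e i" and a: "a \<le> (\<Sum>i=1..s. m i)"
    and p: "\<And>D. D \<subseteq> T \<Longrightarrow> D \<noteq> {} \<Longrightarrow> p \<in> ideal_power (ideal_gen (f ` D)) (mu s m a D)"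
  shows "p * (\<Prod>i=1..s. f i ^ e i) \<in> fold_product_ideal s f m a"
proof -
  interpret power_decomposition f T W
    by fact
  have "coef p \<alpha> * power_product f T \<alpha> * (\<Prod>i=1..s. f i ^ e i) \<in> fold_product_ideal s f m a"
    if \<alpha>: "coef p \<alpha> \<noteq> 0" for \<alpha>
  proof -
    define D where "D = {i\<in>{1..s}. e i + \<alpha> i < m i}"
    have \<alpha>0: "\<alpha> i = 0" if "i \<notin> T" for i
      using coef_nonzero_exponents[OF \<alpha>] that by (auto simp: exponents_def)
    have D: "D \<subseteq> T"
      using e by (force simp: D_def)
    have "power_product f T \<alpha> = (\<Prod>i=1..s. f i ^ \<alpha> i)"
      unfolding power_product_def by (rule prod.mono_neutral_left) (use T \<alpha>0 in auto)
    hence "power_product f T \<alpha> * (\<Prod>i=1..s. f i ^ e i) = (\<Prod>i=1..s. f i ^ (e i + \<alpha> i))"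
      by (simp add: prod.distrib power_add mult.commute)
    moreover have "a \<le> (\<Sum>i=1..s. min (m i) (e i + \<alpha> i))"
    proof (cases "D = {}")
      case True
      hence "m i \<le> e i + \<alpha> i" if "i \<in> {1..s}" for i
        using that by (force simp: D_def)
      hence "(\<Sum>i=1..s. min (m i) (e i + \<alpha> i)) = (\<Sum>i=1..s. m i)"
        by (intro sum.cong) auto
      thus ?thesis
        using a by simp
    next
      case False
      \<comment> \<open>On \<open>D\<close> the minimum is \<open>e i + \<alpha> i\<close>, at least
        \<open>\<alpha> i\<close>; elsewhere it is \<open>m i\<close>. Adding both parts reaches
        \<open>a\<close>.\<close>
      have "a - (\<Sum>i\<in>{1..s} - D. m i) \<le> (\<Sum>i\<in>D. \<alpha> i)"
        using p[OF D False] \<alpha> by (simp add: ideal_power_supported[OF D] supported_def mu_def)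
      moreover have "(\<Sum>i\<in>D. \<alpha> i) \<le> (\<Sum>i\<in>D. min (m i) (e i + \<alpha> i))"
        by (intro sum_mono) (simp add: D_def)
      moreover have "(\<Sum>i\<in>{1..s} - D. m i) = (\<Sum>i\<in>{1..s} - D. min (m i) (e i + \<alpha> i))"
        by (intro sum.cong) (auto simp: D_def)
      moreover have "(\<Sum>i=1..s. min (m i) (e i + \<alpha> i))
          = (\<Sum>i\<in>{1..s} - D. min (m i) (e i + \<alpha> i)) + (\<Sum>i\<in>D. min (m i) (e i + \<alpha> i))"
        by (rule sum.subset_diff) (auto simp: D_def)
      ultimately show ?thesis
        by linarith
    qed
    ultimately have "power_product f T \<alpha> * (\<Prod>i=1..s. f i ^ e i) \<in> fold_product_ideal s f m a"
      using prod_powers_in_fold_product_ideal by simp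
    thus ?thesis
      using ring_ideal.subspace_scale[OF is_ideal_fold_product_ideal] by (simp add: mult.assoc)
  qed
  hence "(\<Sum>\<alpha> | coef p \<alpha> \<noteq> 0. coef p \<alpha> * power_product f T \<alpha> * (\<Prod>i=1..s. f i ^ e i))
      \<in> fold_product_ideal s f m a"
    by (intro ring_ideal.subspace_sum[OF is_ideal_fold_product_ideal]) auto
  thus ?thesis
    by (simp flip: sum_distrib_right expansion_coef)
qed

theorem theorem2p4:
  fixes f :: "nat \<Rightarrow> ('x::finite, 'k::field) mpoly_ring"
    and m :: "nat \<Rightarrow> nat"
    and n s a :: nat
  assumes "infinite (UNIV :: 'k set)"
    and "CARD('x) = n + 1"
    and "s \<ge> n + 1"
    and "inj_on f {1..s}"
    and "generic_forms n (f ` {1..s})"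
    and "a > 0"
    and "\<forall>i\<in>{1..s}. m i > 0"
    and "a \<le> (\<Sum>i=1..s. m i)"
  shows "saturation (fold_product_ideal s f m a) =
    (\<Inter>c\<in>{1..n}. \<Inter>C\<in>{C. C \<subseteq> {1..s} \<and> card C = c}. ideal_power (ideal_gen (f ` C)) (mu s m a C))"
proof -
  let ?I = "fold_product_ideal s f m a"
  have form: "is_form (f i)" if "i \<in> {1..s}" for i
    using assms(5) that by (simp add: generic_forms_def)
  have quasi: "quasi_regular f T" if "T \<subseteq> {1..s}" "card T \<le> n + 1" for T
    using generic_forms_quasi_regular[OF assms(5,4) that(1) finite_subset[OF that(1)] that(2)] by simp
  have decomposition: "\<exists>W. power_decomposition f T W" if T: "T \<subseteq> {1..s}" "card T \<le> n + 1" for T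
    using forms_power_decomposition[OF finite_subset[OF T(1)] quasi[OF T]] form T(1) by blast
  have sub: "p \<in> ideal_power (ideal_gen (f ` D)) (mu s m a D)"
    if p: "p \<in> saturation ?I" and D: "D \<subseteq> {1..s}" "card D \<le> n" for p D
  proof -
    obtain k where k: "\<And>q. q \<in> ideal_power graded_max_ideal k \<Longrightarrow> p * q \<in> ?I"
      using p unfolding saturation_def ideal_colon_def by blast
    \<comment> \<open>As \<open>card D \<le> n < s\<close>, some index \<open>j\<close> is left, and
      \<open>insert j D\<close> is still small enough for a decomposition. In it a power of
      \<open>f j\<close> can be cancelled modulo the power of the ideal of \<open>D\<close>.\<close>
    have "\<not> {1..s} \<subseteq> D"
      using card_mono[of D "{1..s}"] D finite_subset[OF D(1)] assms(3) by auto
    then obtain j where j: "j \<in> {1..s} - D"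
      by blast
    have T: "insert j D \<subseteq> {1..s}" "card (insert j D) \<le> n + 1"
      using j D card_insert_le_m1[of "n + 1" D j] by auto
    obtain W where W: "power_decomposition f (insert j D) W"
      using decomposition[OF T] by blast
    have "f j ^ k * p \<in> ?I"
      using k[OF form_power_in_graded_max_ideal_power[OF form]] j by (simp add: mult.commute)
    hence "f j ^ k * p \<in> ideal_power (ideal_gen (f ` D)) (mu s m a D)"
      using fold_product_ideal_subset_power[OF W _ T(1)] by blast
    thus ?thesis
      using power_decomposition.ideal_power_nonzerodivisor[OF W] j by blast
  qed
  have sup: "p \<in> saturation ?I"
    if p: "\<And>D. D \<subseteq> {1..s} \<Longrightarrow> D \<noteq> {} \<Longrightarrow> card D \<le> n \<Longrightarrow> p \<in> ideal_power (ideal_gen (f ` D)) (mu s m a D)" for p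
  proof -
    \<comment> \<open>The measure is the total deficit of \<open>e\<close> below \<open>m\<close>,
      with truncated differences, so exponents beyond \<open>m\<close> contribute 0.\<close>
    have "p * (\<Prod>i=1..s. f i ^ e i) \<in> saturation ?I" for e
    proof (induction "\<Sum>i=1..s. m i - e i" arbitrary: e rule: less_induct)
      case less
      define C where "C = {i\<in>{1..s}. e i < m i}"
      have C: "C \<subseteq> {1..s}" "finite C"
        by (auto simp: C_def)
      show ?case
      proof (cases "card C \<le> n")
        case True
        then obtain W where W: "power_decomposition f C W"
          using decomposition[OF C(1)] by auto
        have "p * (\<Prod>i=1..s. f i ^ e i) \<in> ?I"
        proof (rule power_intersection_mult_in_fold_product_ideal[OF W C(1) _ assms(8)])
          show "m i \<le> e i" if "i \<in> {1..s} - C" for i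
            using that by (force simp: C_def)
          show "p \<in> ideal_power (ideal_gen (f ` D)) (mu s m a D)" if "D \<subseteq> C" "D \<noteq> {}" for D
            using that C True card_mono[of C D] by (intro p) auto
        qed
        thus ?thesis
          using saturation_superset[OF is_ideal_fold_product_ideal] by blast
      next
        case False
        \<comment> \<open>With as many forms as variables, the ideal of \<open>T\<close> contains
          all monomials of some degree \<open>k\<close>.\<close>
        then obtain T where T: "T \<subseteq> C" "card T = n + 1" "finite T"
          using obtain_subset_with_card_n[of "n + 1" C] by auto
        obtain k where k: "\<And>u. total_degree u = k \<Longrightarrow> monomial u \<in> ideal_gen (f ` T)"
          using quasi_regular_forms_primary[OF T(3) quasi form] T C(1) assms(2)
          by (metis order_refl subset_iff)
        have "p * (\<Prod>i=1..s. f i ^ e i) * f j \<in> saturation ?I" if "j \<in> T" for j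
        proof -
          have j: "j \<in> {1..s}" "e j < m j"
            using that T(1) by (auto simp: C_def)
          define e' where "e' = e(j := Suc (e j))"
          \<comment> \<open>Strict because \<open>e j < m j\<close> for \<open>j\<close> in
            \<open>C\<close>, so the truncated difference at \<open>j\<close> really drops.\<close>
          have "(\<Sum>i=1..s. m i - e' i) < (\<Sum>i=1..s. m i - e i)"
            by (rule sum_strict_mono_ex1) (use j in \<open>auto simp: e'_def\<close>)
          hence "p * (\<Prod>i=1..s. f i ^ e' i) \<in> saturation ?I"
            by (rule less)
          moreover have "(\<Prod>i=1..s. f i ^ e' i) = (\<Prod>i=1..s. f i ^ e i) * f j"
            using power_product_Suc[OF _ j(1), of f e] by (simp add: power_product_def e'_def mult.commute)
          ultimately show ?thesis
            by (simp add: mult.assoc)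
        qed
        hence "f ` T \<subseteq> {x. p * (\<Prod>i=1..s. f i ^ e i) * x \<in> saturation ?I}"
          by blast
        hence "ideal_gen (f ` T) \<subseteq> {x. p * (\<Prod>i=1..s. f i ^ e i) * x \<in> saturation ?I}"
          by (intro ring_ideal.span_minimal multiples_ideal is_ideal_saturation is_ideal_fold_product_ideal)
        hence "p * (\<Prod>i=1..s. f i ^ e i) * monomial u \<in> saturation ?I" if "total_degree u = k" for u
          using k[OF that] by blast
        thus ?thesis
          by (rule saturation_idempotent[OF is_ideal_fold_product_ideal])
      qed
    qed
    from this[of "\<lambda>_. 0"] show ?thesis
      by simp
  qed
  show ?thesis
  proof (intro subset_antisym subsetI INT_I)
    fix p c C assume "p \<in> saturation ?I" "c \<in> {1..n}" "C \<in> {C. C \<subseteq> {1..s} \<and> card C = c}"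
    thus "p \<in> ideal_power (ideal_gen (f ` C)) (mu s m a C)"
      by (intro sub) auto
  next
    fix p assume p: "p \<in> (\<Inter>c\<in>{1..n}. \<Inter>C\<in>{C. C \<subseteq> {1..s} \<and> card C = c}.
      ideal_power (ideal_gen (f ` C)) (mu s m a C))"
    show "p \<in> saturation ?I"
    proof (rule sup)
      fix D assume D: "D \<subseteq> {1..s}" "D \<noteq> {}" "card D \<le> n"
      hence "card D \<in> {1..n}"
        using finite_subset[OF D(1)] by (simp add: Suc_le_eq card_gt_0_iff)
      thus "p \<in> ideal_power (ideal_gen (f ` D)) (mu s m a D)"
        using p D(1) by blast
    qed
  qed
qed

end
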